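(* Let $G_0=SO(\infty,q)$, $q\leqq\infty$. The domain $D_0$ of all $(0,F^{(1)},V_0)\in\mathfrak X_{\mathcal F,E}$ with $F^{(1)}$ a maximal negative definite subspace of $V_0$ is realized as the bounded domain of all finitary real linear maps $X:(V_0)_-\to(V_0)_+$ such that $I-{}^tX\,X$ is positive definite, where $(0,F^{(1)},V_0)$ corresponds to the map $X$ given by $\pi_-(x)\mapsto\pi_+(x)$ for $x\in F^{(1)}$; and there the action of $G_0$ is $$\begin{pmatrix}A&B\\C&D\end{pmatrix}:X\mapsto(AX+B)(CX+D)^{-1}.$$
   Context: $V_0$ is the real vector space with countable basis $E=\{\dots,e_{-2},e_{-1},e_1,\dots,e_q\}$ if $q<\infty$, $E=\{\dots,e_{-2},e_{-1},e_1,e_2,\dots\}$ if $q=\infty$, with symmetric bilinear form $b(e_i,e_j)=\delta_{i,j}$ for $i<0$, $b(e_i,e_j)=-\delta_{i,j}$ for $i>0$. $(V_0)_+=\mathrm{Span}_{\mathbb R}\{e_i\mid i<0\}$, $(V_0)_-=\mathrm{Span}_{\mathbb R}\{e_i\mid i>0\}$, with $b$-orthogonal projections $\pi_\pm:V_0\to(V_0)_\pm$. $G=SL(\infty+q;\mathbb R)$ is the group of real linear transformations of $V_0$ of determinant $1$ fixing all but finitely many elements of $E$; $G_0=SO(\infty,q)$ is the topological identity component of the subgroup of $G$ preserving $b$. Elements of $G_0$ are written in block form relative to $V_0=(V_0)_+\oplus(V_0)_-$. With $\mathcal F=(0,(V_0)_-,V_0)$, $\mathfrak X_{\mathcal F,E}=G(\mathcal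 F)$ is the real flag (Grassmann) manifold. A linear map $X$ is finitary if its matrix relative to $E$ has only finitely many nonzero entries; ${}^tX$ is the transpose. *)

theory Defs
  imports "HOL-Analysis.Analysis" "HOL-Analysis.Finite_Function_Topology" "HOL-Combinatorics.Permutations"
begin

(* V_0 is modelled as the external direct sum of (V_0)_+ and (V_0)_-. The basis vector e_{-(n+1)} is
   basis (Inl n), and the e_i with i > 0 are the basis (Inr j) with j in the nonempty countable
   type 'q; thus q = CARD('q) if 'q is finite and q = \<infinity> otherwise. *)

type_synonym Vplus = "nat \<Rightarrow>\<^sub>0 real"
type_synonym 'q Vminus = "'q \<Rightarrow>\<^sub>0 real"
type_synonym 'q V = "Vplus \<times> 'q Vminus"

fun basis :: "nat + 'q \<Rightarrow> 'q V" where
  "basis (Inl n) = (Poly_Mapping.single n 1, 0)"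
| "basis (Inr j) = (0, Poly_Mapping.single j 1)"

fun coord :: "'q V \<Rightarrow> nat + 'q \<Rightarrow> real" where
  "coord x (Inl n) = Poly_Mapping.lookup (fst x) n"
| "coord x (Inr j) = Poly_Mapping.lookup (snd x) j"

abbreviation proj_plus :: "'q V \<Rightarrow> Vplus" where "proj_plus \<equiv> fst"
abbreviation proj_minus :: "'q V \<Rightarrow> 'q Vminus" where "proj_minus \<equiv> snd"

definition dot :: "('i \<Rightarrow>\<^sub>0 real) \<Rightarrow> ('i \<Rightarrow>\<^sub>0 real) \<Rightarrow> real" where
  "dot x y = (\<Sum>i\<in>Poly_Mapping.keys x. Poly_Mapping.lookup x i * Poly_Mapping.lookup y i)"

definition form_b :: "'q V \<Rightarrow> 'q V \<Rightarrow> real" where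
  "form_b x y = dot (proj_plus x) (proj_plus y) - dot (proj_minus x) (proj_minus y)"

definition Vminus_space :: "'q V set" where
  "Vminus_space = span (range (\<lambda>j. basis (Inr j)))"


subsection \<open>Topologies on direct limits and on orbits\<close>

definition direct_limit_topology :: "'i set \<Rightarrow> ('i \<Rightarrow> 'a topology) \<Rightarrow> 'a topology" where
  "direct_limit_topology I T =
     topology (\<lambda>U. U \<subseteq> (\<Union>i\<in>I. topspace (T i)) \<and> (\<forall>i\<in>I. openin (T i) (U \<inter> topspace (T i))))"

definition quotient_topology :: "'a topology \<Rightarrow> ('a \<Rightarrow> 'c) \<Rightarrow> 'c topology" where
  "quotient_topology T f =
     topology (\<lambda>W. W \<subseteq> f ` topspace T \<and> openin T {x \<in> topspace T. f x \<in> W})"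

definition domain_in :: "'a topology \<Rightarrow> 'a set \<Rightarrow> bool" where
  "domain_in T S \<longleftrightarrow> openin T S \<and> connectedin T S \<and> S \<noteq> {}"

lemma openin_direct_limit_topology:
  "openin (direct_limit_topology I T) U \<longleftrightarrow>
     U \<subseteq> (\<Union>i\<in>I. topspace (T i)) \<and> (\<forall>i\<in>I. openin (T i) (U \<inter> topspace (T i)))"
proof -
  have "istopology (\<lambda>U. U \<subseteq> (\<Union>i\<in>I. topspace (T i)) \<and> (\<forall>i\<in>I. openin (T i) (U \<inter> topspace (T i))))"
    unfolding istopology_def
  proof (intro conjI allI impI)
    fix A B
    assume A: "A \<subseteq> (\<Union>i\<in>I. topspace (T i)) \<and> (\<forall>i\<in>I. openin (T i) (A \<inter> topspace (T i)))"
      and B: "B \<subseteq> (\<Union>i\<in>I. topspace (T i)) \<and> (\<forall>i\<in>I. openin (T i) (B \<inter> topspace (T i)))"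
    show "A \<inter> B \<subseteq> (\<Union>i\<in>I. topspace (T i))" using A by blast
    show "\<forall>i\<in>I. openin (T i) (A \<inter> B \<inter> topspace (T i))"
    proof
      fix i assume "i \<in> I"
      then have "openin (T i) ((A \<inter> topspace (T i)) \<inter> (B \<inter> topspace (T i)))"
        using A B by blast
      moreover have "(A \<inter> topspace (T i)) \<inter> (B \<inter> topspace (T i)) = A \<inter> B \<inter> topspace (T i)"
        by blast
      ultimately show "openin (T i) (A \<inter> B \<inter> topspace (T i))" by simp
    qed
  next
    fix K
    assume K: "\<forall>A\<in>K. A \<subseteq> (\<Union>i\<in>I. topspace (T i)) \<and> (\<forall>i\<in>I. openin (T i) (A \<inter> topspace (T i)))"
    show "\<Union> K \<subseteq> (\<Union>i\<in>I. topspace (T i))" using K by blast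
    show "\<forall>i\<in>I. openin (T i) (\<Union> K \<inter> topspace (T i))"
    proof
      fix i assume "i \<in> I"
      then have "openin (T i) (\<Union>A\<in>K. A \<inter> topspace (T i))"
        using K by blast
      then show "openin (T i) (\<Union> K \<inter> topspace (T i))" by (simp add: Int_commute Int_Union)
    qed
  qed
  then show ?thesis unfolding direct_limit_topology_def by (simp add: topology_inverse')
qed

lemma openin_quotient_topology:
  "openin (quotient_topology T f) W \<longleftrightarrow>
     W \<subseteq> f ` topspace T \<and> openin T {x \<in> topspace T. f x \<in> W}"
proof -
  have "istopology (\<lambda>W. W \<subseteq> f ` topspace T \<and> openin T {x \<in> topspace T. f x \<in> W})"
    unfolding istopology_def
  proof (intro conjI allI impI)
    fix A B
    assume A: "A \<subseteq> f ` topspace T \<and> openin T {x \<in> topspace T. f x \<in> A}"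
      and B: "B \<subseteq> f ` topspace T \<and> openin T {x \<in> topspace T. f x \<in> B}"
    show "A \<inter> B \<subseteq> f ` topspace T" using A by blast
    have "openin T ({x \<in> topspace T. f x \<in> A} \<inter> {x \<in> topspace T. f x \<in> B})"
      using A B by (blast intro: openin_Int)
    moreover have "{x \<in> topspace T. f x \<in> A} \<inter> {x \<in> topspace T. f x \<in> B} = {x \<in> topspace T. f x \<in> A \<inter> B}"
      by blast
    ultimately show "openin T {x \<in> topspace T. f x \<in> A \<inter> B}" by (simp only:)
  next
    fix K
    assume K: "\<forall>A\<in>K. A \<subseteq> f ` topspace T \<and> openin T {x \<in> topspace T. f x \<in> A}"
    show "\<Union> K \<subseteq> f ` topspace T" using K by blast
    have "openin T (\<Union>A\<in>K. {x \<in> topspace T. f x \<in> A})" using K by (blast intro: openin_Union)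
    moreover have "(\<Union>A\<in>K. {x \<in> topspace T. f x \<in> A}) = {x \<in> topspace T. f x \<in> \<Union> K}" by blast
    ultimately show "openin T {x \<in> topspace T. f x \<in> \<Union> K}" by (simp only:)
  qed
  then show ?thesis unfolding quotient_topology_def by (simp add: topology_inverse')
qed


subsection \<open>The groups\<close>

definition mat_entry :: "('q V \<Rightarrow> 'q V) \<Rightarrow> nat + 'q \<Rightarrow> nat + 'q \<Rightarrow> real" where
  "mat_entry g i j = coord (g (basis j)) i"

definition moved :: "('q V \<Rightarrow> 'q V) \<Rightarrow> (nat + 'q) set" where
  "moved g = {i. g (basis i) \<noteq> basis i}"

(* The matrix of g is block triangular with an identity block in the coordinates outside the finite
   set moved g, so the determinant of g is that of its moved g \<times> moved g block. *)
definition fin_det :: "('q V \<Rightarrow> 'q V) \<Rightarrow> real" where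
  "fin_det g =
     (\<Sum>p | p permutes moved g. of_int (sign p) * (\<Prod>i\<in>moved g. mat_entry g i (p i)))"

definition SL :: "('q V \<Rightarrow> 'q V) set" where
  "SL = {g. linear g \<and> bij g \<and> finite (moved g) \<and> fin_det g = 1}"

definition SL_level :: "(nat + 'q) set \<Rightarrow> ('q V \<Rightarrow> 'q V) set" where
  "SL_level S = {g \<in> SL. \<forall>i j. i \<notin> S \<or> j \<notin> S \<longrightarrow> mat_entry g i j = (if i = j then 1 else 0)}"

(* On each finite level the topology is that of convergence of the matrix entries. *)
definition SL_topology :: "('q V \<Rightarrow> 'q V) topology" where
  "SL_topology =
     direct_limit_topology {S. finite S} (\<lambda>S. pullback_topology (SL_level S) mat_entry euclidean)"

definition G0 :: "('q V \<Rightarrow> 'q V) set" where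
  "G0 = connected_component_of_set
     (subtopology SL_topology {g \<in> SL. \<forall>x y. form_b (g x) (g y) = form_b x y}) id"

definition block_A :: "('q V \<Rightarrow> 'q V) \<Rightarrow> Vplus \<Rightarrow> Vplus" where
  "block_A g u = proj_plus (g (u, 0))"
definition block_B :: "('q V \<Rightarrow> 'q V) \<Rightarrow> 'q Vminus \<Rightarrow> Vplus" where
  "block_B g v = proj_plus (g (0, v))"
definition block_C :: "('q V \<Rightarrow> 'q V) \<Rightarrow> Vplus \<Rightarrow> 'q Vminus" where
  "block_C g u = proj_minus (g (u, 0))"
definition block_D :: "('q V \<Rightarrow> 'q V) \<Rightarrow> 'q Vminus \<Rightarrow> 'q Vminus" where
  "block_D g v = proj_minus (g (0, v))"


subsection \<open>The flag manifold and the domain\<close>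

type_synonym 'q flag = "'q V set \<times> 'q V set \<times> 'q V set"

fun flag_act :: "('q V \<Rightarrow> 'q V) \<Rightarrow> 'q flag \<Rightarrow> 'q flag" where
  "flag_act g (F0, F1, F2) = (g ` F0, g ` F1, g ` F2)"

definition base_flag :: "'q flag" where
  "base_flag = ({0}, Vminus_space, UNIV)"

definition flag_manifold :: "'q flag set" where
  "flag_manifold = (\<lambda>g. flag_act g base_flag) ` SL"

definition flag_topology :: "'q flag topology" where
  "flag_topology = quotient_topology SL_topology (\<lambda>g. flag_act g base_flag)"

definition neg_def_subspace :: "'q V set \<Rightarrow> bool" where
  "neg_def_subspace W \<longleftrightarrow> subspace W \<and> (\<forall>x\<in>W. x \<noteq> 0 \<longrightarrow> form_b x x < 0)"

definition max_neg_def_subspace :: "'q V set \<Rightarrow> bool" where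
  "max_neg_def_subspace W \<longleftrightarrow>
     neg_def_subspace W \<and> (\<forall>W'. neg_def_subspace W' \<and> W \<subseteq> W' \<longrightarrow> W' = W)"

definition D0 :: "'q flag set" where
  "D0 = {({0}, F1, UNIV) | F1. ({0}, F1, UNIV) \<in> flag_manifold \<and> max_neg_def_subspace F1}"


subsection \<open>Finitary maps and the bounded domain\<close>

definition entry :: "('q Vminus \<Rightarrow> Vplus) \<Rightarrow> nat \<Rightarrow> 'q \<Rightarrow> real" where
  "entry X i j = Poly_Mapping.lookup (X (Poly_Mapping.single j 1)) i"

definition finitary_maps :: "('q Vminus \<Rightarrow> Vplus) set" where
  "finitary_maps = {X. linear X \<and> finite {(i, j). entry X i j \<noteq> 0}}"

definition finitary_level :: "nat set \<times> 'q set \<Rightarrow> ('q Vminus \<Rightarrow> Vplus) set" where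
  "finitary_level S = {X \<in> finitary_maps. \<forall>i j. entry X i j \<noteq> 0 \<longrightarrow> i \<in> fst S \<and> j \<in> snd S}"

definition finitary_topology :: "('q Vminus \<Rightarrow> Vplus) topology" where
  "finitary_topology =
     direct_limit_topology {S. finite (fst S) \<and> finite (snd S)}
       (\<lambda>S. pullback_topology (finitary_level S) entry euclidean)"

(* Meaningful for finitary X: the j-th coordinate of the image of y is \<Sum>i. entry X i j * y_i. *)
definition transpose_map :: "('q Vminus \<Rightarrow> Vplus) \<Rightarrow> Vplus \<Rightarrow> 'q Vminus" where
  "transpose_map X y =
     (\<Sum>j | \<exists>i. entry X i j \<noteq> 0.
        Poly_Mapping.single j (\<Sum>i\<in>Poly_Mapping.keys y. entry X i j * Poly_Mapping.lookup y i))"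

definition pos_def_map :: "('q Vminus \<Rightarrow> 'q Vminus) \<Rightarrow> bool" where
  "pos_def_map T \<longleftrightarrow>
     (\<forall>v w. dot (T v) w = dot v (T w)) \<and> (\<forall>v. v \<noteq> 0 \<longrightarrow> 0 < dot (T v) v)"

definition bounded_realization :: "('q Vminus \<Rightarrow> Vplus) set" where
  "bounded_realization = {X \<in> finitary_maps. pos_def_map (\<lambda>v. v - transpose_map X (X v))}"

(* Boundedness in the operator norm for the l2 norms; the norm that the library puts on finitely
   supported functions is the l1 norm. *)
definition bounded_maps :: "('q Vminus \<Rightarrow> Vplus) set \<Rightarrow> bool" where
  "bounded_maps S \<longleftrightarrow>
     (\<exists>M. \<forall>X\<in>S. \<forall>v. sqrt (dot (X v) (X v)) \<le> M * sqrt (dot v v))"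

(* For x in F1: proj_minus x is sent to proj_plus x. *)
fun flag_map :: "'q flag \<Rightarrow> 'q Vminus \<Rightarrow> Vplus" where
  "flag_map (F0, F1, F2) v = proj_plus (THE x. x \<in> F1 \<and> proj_minus x = v)"

end

theory Submission
  imports Defs
begin

text \<open>
  A negative definite subspace meets \<open>(V\<^sub>0)\<^sub>+\<close> trivially, so \<open>\<pi>\<^sub>-\<close> is injective on it. If the subspace
  is \<open>g (V\<^sub>0)\<^sub>-\<close> with \<open>g\<close> injective and equal to the identity off a finite set of coordinates, then a
  dimension count in these coordinates shows that \<open>\<pi>\<^sub>-\<close> is also surjective, and the subspace is the
  graph of the finitary strict contraction \<open>X = B D\<inverse>\<close>. Conversely the graph of \<open>X\<close> is the image of
  \<open>(V\<^sub>0)\<^sub>-\<close> under the shear \<open>(u, v) \<mapsto> (u + X v, v)\<close>, which has determinant \<open>1\<close> and depends continuously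
  on \<open>X\<close>. The same dimension count applied to \<open>g\<close> composed with the shear of \<open>X\<close> yields the
  fractional linear action, without any multiplicativity of determinants. On each finite level
  openness follows from compactness of the unit sphere.
\<close>

subsection \<open>Finitely supported vectors\<close>

lemma lookup_scaleR [simp]: "Poly_Mapping.lookup (c *\<^sub>R x) i = c * Poly_Mapping.lookup x i"
  for x :: "'i \<Rightarrow>\<^sub>0 real"
  unfolding scaleR_poly_mapping_def by (simp add: lookup_Abs_poly_mapping)

lemma lookup_eqI: "(\<And>i. Poly_Mapping.lookup x i = Poly_Mapping.lookup y i) \<Longrightarrow> x = y"
  by (simp add: poly_mapping_eq_iff fun_eq_iff)

lemma poly_mapping_expansion:
  fixes x :: "'i \<Rightarrow>\<^sub>0 real"
  assumes "finite A" "Poly_Mapping.keys x \<subseteq> A"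
  shows "x = (\<Sum>j\<in>A. Poly_Mapping.lookup x j *\<^sub>R Poly_Mapping.single j 1)"
proof (rule lookup_eqI)
  fix i
  have "(\<Sum>j\<in>A. Poly_Mapping.lookup x j * (1 when j = i)) = (\<Sum>j\<in>A. if j = i then Poly_Mapping.lookup x j else 0)"
    by (rule sum.cong) (auto simp: when_def)
  also have "\<dots> = Poly_Mapping.lookup x i"
    using assms by (auto simp: sum.delta in_keys_iff)
  finally show "Poly_Mapping.lookup x i
      = Poly_Mapping.lookup (\<Sum>j\<in>A. Poly_Mapping.lookup x j *\<^sub>R Poly_Mapping.single j 1) i"
    by (simp add: lookup_sum lookup_single)
qed

lemma linear_expansion:
  fixes f :: "('i \<Rightarrow>\<^sub>0 real) \<Rightarrow> 'b::real_vector"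
  assumes "linear f" "finite A" "Poly_Mapping.keys x \<subseteq> A"
  shows "f x = (\<Sum>j\<in>A. Poly_Mapping.lookup x j *\<^sub>R f (Poly_Mapping.single j 1))"
proof -
  have "f x = f (\<Sum>j\<in>A. Poly_Mapping.lookup x j *\<^sub>R Poly_Mapping.single j 1)"
    using poly_mapping_expansion[OF assms(2,3)] by simp
  also have "\<dots> = (\<Sum>j\<in>A. Poly_Mapping.lookup x j *\<^sub>R f (Poly_Mapping.single j 1))"
    using assms(1) by (simp add: linear_sum linear_scale)
  finally show ?thesis .
qed

lemma linear_inv_bij:
  assumes "linear f" "bij f"
  shows "linear (inv f)"
proof (rule linearI)
  have f: "f (inv f y) = y" for y using assms(2) by (simp add: bij_is_surj surj_f_inv_f)
  show "inv f (x + y) = inv f x + inv f y" for x y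
    by (rule inv_f_eq[OF bij_is_inj[OF assms(2)]]) (simp add: linear_add[OF assms(1)] f)
  show "inv f (c *\<^sub>R x) = c *\<^sub>R inv f x" for c x
    by (rule inv_f_eq[OF bij_is_inj[OF assms(2)]]) (simp add: linear_scale[OF assms(1)] f)
qed

section \<open>The Euclidean inner product on finitely supported vectors\<close>

lemma dot_eq_sum:
  assumes "finite A" "Poly_Mapping.keys x \<subseteq> A \<or> Poly_Mapping.keys y \<subseteq> A"
  shows "dot x y = (\<Sum>i\<in>A. Poly_Mapping.lookup x i * Poly_Mapping.lookup y i)"
proof -
  have "dot x y = (\<Sum>i\<in>Poly_Mapping.keys x \<inter> Poly_Mapping.keys y. Poly_Mapping.lookup x i * Poly_Mapping.lookup y i)"
    unfolding dot_def by (rule sum.mono_neutral_right) (auto simp: in_keys_iff)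
  also have "\<dots> = (\<Sum>i\<in>A. Poly_Mapping.lookup x i * Poly_Mapping.lookup y i)"
    by (rule sum.mono_neutral_left) (use assms in \<open>auto simp: in_keys_iff\<close>)
  finally show ?thesis .
qed

lemma dot_commute: "dot x y = dot y x"
proof -
  have "dot x y = (\<Sum>i\<in>Poly_Mapping.keys y. Poly_Mapping.lookup x i * Poly_Mapping.lookup y i)"
    by (rule dot_eq_sum) auto
  then show ?thesis by (simp add: dot_def mult.commute)
qed

lemma dot_diff_left: "dot (x - y) z = dot x z - dot y z"
proof -
  have "dot u z = (\<Sum>i\<in>Poly_Mapping.keys z. Poly_Mapping.lookup u i * Poly_Mapping.lookup z i)" for u
    by (rule dot_eq_sum) auto
  then show ?thesis by (simp add: lookup_minus algebra_simps sum_subtractf)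
qed

lemma dot_scaleR: "dot (c *\<^sub>R x) (c *\<^sub>R x) = c\<^sup>2 * dot x x"
proof -
  have "dot (c *\<^sub>R x) (c *\<^sub>R x) = (\<Sum>i\<in>Poly_Mapping.keys x. Poly_Mapping.lookup (c *\<^sub>R x) i * Poly_Mapping.lookup (c *\<^sub>R x) i)"
    by (rule dot_eq_sum) (auto simp: in_keys_iff)
  then show ?thesis by (simp add: dot_def sum_distrib_left power2_eq_square mult_ac)
qed

lemma dot_zero [simp]: "dot 0 x = 0" "dot x 0 = 0"
  by (simp_all add: dot_def)

lemma dot_self_nonneg: "0 \<le> dot x x"
  by (simp add: dot_def sum_nonneg)

lemma dot_self_pos: "x \<noteq> 0 \<Longrightarrow> 0 < dot x x"
  by (auto simp: dot_def in_keys_iff intro!: sum_pos)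
    (metis in_keys_iff not_real_square_gt_zero)

text \<open>Lets the l2 norm control single matrix entries when continuity is proved.\<close>

lemma lookup_square_le_dot: "(Poly_Mapping.lookup x i)\<^sup>2 \<le> dot x x"
proof (cases "i \<in> Poly_Mapping.keys x")
  case True
  then show ?thesis
    unfolding dot_def power2_eq_square by (intro member_le_sum) auto
next
  case False
  then show ?thesis by (simp add: in_keys_iff dot_self_nonneg)
qed

lemma Vminus_space_eq: "Vminus_space = range (Pair 0)"
proof
  have "subspace (range (Pair (0::Vplus) :: 'a Vminus \<Rightarrow> 'a V))"
  proof (rule subspaceI)
    show "0 \<in> range (Pair (0::Vplus) :: 'a Vminus \<Rightarrow> 'a V)" by (auto simp: zero_prod_def)
  qed auto
  then show "Vminus_space \<subseteq> range (Pair (0::Vplus) :: 'a Vminus \<Rightarrow> 'a V)"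
    unfolding Vminus_space_def by (intro span_minimal) auto
  show "range (Pair (0::Vplus) :: 'a Vminus \<Rightarrow> 'a V) \<subseteq> Vminus_space"
  proof clarify
    fix v :: "'a Vminus"
    have "linear (Pair (0::Vplus) :: 'a Vminus \<Rightarrow> 'a V)"
      by (rule linearI) auto
    from linear_expansion[OF this finite_keys order_refl, of v]
    have "(0, v) = (\<Sum>j\<in>Poly_Mapping.keys v. Poly_Mapping.lookup v j *\<^sub>R basis (Inr j))" by simp
    also have "\<dots> \<in> Vminus_space"
      unfolding Vminus_space_def by (intro span_sum span_scale span_base) auto
    finally show "(0, v) \<in> Vminus_space" .
  qed
qed

lemma image_Vminus_space: "h ` Vminus_space = range (\<lambda>v. h (0, v))"
  by (auto simp: Vminus_space_eq)


subsection \<open>Graphs and shears\<close>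

definition graph :: "('q Vminus \<Rightarrow> Vplus) \<Rightarrow> 'q V set" where
  "graph X = range (\<lambda>v. (X v, v))"

definition graph_flag :: "('q Vminus \<Rightarrow> Vplus) \<Rightarrow> 'q flag" where
  "graph_flag X = ({0}, graph X, UNIV)"

text \<open>The unipotent block matrix with \<open>X\<close> in the upper right corner. It moves the
  base point to the graph of \<open>X\<close> and thereby lifts \<open>graph_flag\<close> to the
  group.\<close>

definition shear :: "('q Vminus \<Rightarrow> Vplus) \<Rightarrow> 'q V \<Rightarrow> 'q V" where
  "shear X x = (fst x + X (snd x), snd x)"

text \<open>Positive definiteness of \<open>I\<close> minus transpose of \<open>X\<close> times
  \<open>X\<close>, written through l2 norms so that no transpose appears.\<close>

definition strict_contraction :: "('q Vminus \<Rightarrow> Vplus) \<Rightarrow> bool" where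
  "strict_contraction X \<longleftrightarrow> (\<forall>v. v \<noteq> 0 \<longrightarrow> dot (X v) (X v) < dot v v)"

lemma linear_shear: "linear X \<Longrightarrow> linear (shear X)"
  by (rule linearI) (auto simp: shear_def linear_add linear_scale algebra_simps)

lemma bij_shear: "bij (shear X)"
  by (rule o_bij[where g = "shear (\<lambda>v. - X v)"]) (auto simp: shear_def fun_eq_iff)

lemma shear_basis_Inl: "linear X \<Longrightarrow> shear X (basis (Inl n)) = basis (Inl n)"
  by (simp add: shear_def linear_0)

lemma coord_basis: "coord (basis j) i = (if i = j then 1 else 0)"
  by (cases i; cases j) (auto simp: lookup_single when_def)

lemma mat_entry_shear:
  assumes "linear X"
  shows "mat_entry (shear X) i j =
    (case (i, j) of (Inl m, Inr k) \<Rightarrow> entry X m k | _ \<Rightarrow> if i = j then 1 else 0)"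
proof (cases j)
  case (Inl n)
  then show ?thesis
    by (cases i) (simp_all add: mat_entry_def shear_basis_Inl[OF assms] coord_basis del: basis.simps coord.simps)
next
  case (Inr k)
  then show ?thesis
    by (cases i) (auto simp: mat_entry_def shear_def entry_def lookup_single when_def)
qed

lemma moved_shear:
  assumes "linear X"
  shows "moved (shear X) \<subseteq> Inr ` {j. X (Poly_Mapping.single j 1) \<noteq> 0}"
proof
  fix i assume i: "i \<in> moved (shear X)"
  show "i \<in> Inr ` {j. X (Poly_Mapping.single j 1) \<noteq> 0}"
  proof (cases i)
    case (Inl n)
    then show ?thesis using i shear_basis_Inl[OF assms] by (simp add: moved_def del: basis.simps)
  next
    case (Inr k)
    then show ?thesis using i by (auto simp: moved_def shear_def)
  qed
qed

lemma finitary_support: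
  assumes "X \<in> finitary_maps"
  obtains S where "finite (fst S)" "finite (snd S)" "X \<in> finitary_level S"
proof
  let ?E = "{(i, j). entry X i j \<noteq> 0}"
  have "finite ?E" using assms by (simp add: finitary_maps_def)
  then show "finite (fst (fst ` ?E, snd ` ?E))" "finite (snd (fst ` ?E, snd ` ?E))" by auto
  show "X \<in> finitary_level (fst ` ?E, snd ` ?E)"
    using assms by (force simp: finitary_level_def)
qed

lemma finite_moved_shear:
  assumes "X \<in> finitary_maps"
  shows "finite (moved (shear X))"
proof -
  obtain S where S: "finite (snd S)" "X \<in> finitary_level S"
    using finitary_support[OF assms] by metis
  have "{j. X (Poly_Mapping.single j 1) \<noteq> 0} \<subseteq> snd S"
  proof
    fix j assume "j \<in> {j. X (Poly_Mapping.single j 1) \<noteq> 0}"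
    then obtain i where "entry X i j \<noteq> 0"
      unfolding entry_def using lookup_eqI[of "X (Poly_Mapping.single j 1)" 0] by auto
    then show "j \<in> snd S" using S by (auto simp: finitary_level_def)
  qed
  with S(1) have "finite {j. X (Poly_Mapping.single j 1) \<noteq> 0}" by (rule finite_subset[rotated])
  moreover have "linear X" using assms by (simp add: finitary_maps_def)
  ultimately show ?thesis using moved_shear finite_subset by blast
qed

text \<open>Every moved index has the form \<open>Inr j\<close>, and the rows of the shear at such
  indices are rows of the identity matrix. So the moved block is an identity matrix, and only the
  identity permutation contributes to the Leibniz sum.\<close>

lemma shear_in_SL:
  assumes "X \<in> finitary_maps"
  shows "shear X \<in> SL"
proof -
  have lin: "linear X" using assms by (simp add: finitary_maps_def)
  have fin: "finite (moved (shear X))" by (rule finite_moved_shear[OF assms])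
  have ent: "mat_entry (shear X) i j = (if i = j then 1 else 0)"
    if "i \<in> moved (shear X)" for i j
    using moved_shear[OF lin] that by (auto simp: mat_entry_shear[OF lin] split: sum.splits)
  have "fin_det (shear X) = (\<Sum>p | p permutes moved (shear X). if p = id then 1 else 0)"
    unfolding fin_det_def
  proof (rule sum.cong)
    fix p assume "p \<in> {p. p permutes moved (shear X)}"
    then have p: "p permutes moved (shear X)" by simp
    show "of_int (sign p) * (\<Prod>i\<in>moved (shear X). mat_entry (shear X) i (p i))
        = (if p = id then 1 else (0::real))"
    proof (cases "p = id")
      case True
      then show ?thesis by (simp add: ent sign_id)
    next
      case False
      then obtain i where i: "p i \<noteq> i" by (auto simp: fun_eq_iff)
      then have "i \<in> moved (shear X)" using p by (metis permutes_not_in)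
      then have "\<exists>i\<in>moved (shear X). mat_entry (shear X) i (p i) = 0"
        using i ent by (intro bexI[of _ i]) auto
      then show ?thesis using False fin by (simp add: prod_zero)
    qed
  qed simp
  also have "\<dots> = 1"
    using fin by (simp add: finite_permutations permutes_id)
  finally show ?thesis
    using lin fin by (simp add: SL_def linear_shear bij_shear)
qed

lemma graph_eq_shear: "graph X = shear X ` Vminus_space"
  by (simp add: image_Vminus_space graph_def shear_def)

lemma flag_act_base:
  assumes "linear g" "bij g"
  shows "flag_act g base_flag = ({0}, g ` Vminus_space, UNIV)"
  using assms by (simp add: base_flag_def linear_0 bij_is_surj)

lemma graph_flag_eq_shear:
  assumes "linear X" shows "graph_flag X = flag_act (shear X) base_flag"
  by (simp add: flag_act_base linear_shear bij_shear assms graph_flag_def graph_eq_shear)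

text \<open>A graph has exactly one point over each \<open>v\<close>, as the definite description in
  \<open>flag_map\<close> requires. This makes \<open>flag_map\<close> a left inverse of
  \<open>graph_flag\<close>.\<close>

lemma flag_map_graph_flag [simp]: "flag_map (graph_flag X) = X"
proof
  fix v
  have "(THE x. x \<in> graph X \<and> snd x = v) = (X v, v)"
    by (rule the_equality) (auto simp: graph_def)
  then show "flag_map (graph_flag X) v = X v" by (simp add: graph_flag_def)
qed

lemma subspace_graph: "linear X \<Longrightarrow> subspace (graph X)"
  unfolding graph_eq_shear Vminus_space_def
  by (intro linear_subspace_image linear_shear subspace_span)

text \<open>At the point \<open>(X v, v)\<close> the form takes the value
  \<open>dot (X v) (X v) - dot v v\<close>.\<close>

lemma neg_def_graph_iff:
  assumes "linear X"
  shows "neg_def_subspace (graph X) \<longleftrightarrow> strict_contraction X"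
proof -
  have "(X v, v) \<noteq> 0 \<longleftrightarrow> v \<noteq> 0" for v
    using assms by (auto simp: zero_prod_def linear_0)
  then show ?thesis
    using subspace_graph[OF assms]
    by (simp add: neg_def_subspace_def strict_contraction_def graph_def form_b_def)
qed

text \<open>The difference of the two points lies in the subspace and also in (V_0)_+, where the
  form is nonnegative; hence it vanishes.\<close>

lemma neg_def_inj_proj:
  assumes "neg_def_subspace W" "x \<in> W" "y \<in> W" "snd x = snd y"
  shows "x = y"
proof (rule ccontr)
  assume "x \<noteq> y"
  moreover have "x - y \<in> W"
    using assms by (simp add: neg_def_subspace_def subspace_diff)
  ultimately have "form_b (x - y) (x - y) < 0"
    using assms(1) by (auto simp: neg_def_subspace_def)
  then show False using assms(4) dot_self_nonneg[of "fst (x - y)"] by (simp add: form_b_def)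
qed

text \<open>A graph already has a point over every vector of (V_0)_-, and a negative definite
  subspace has at most one, so nothing can be added.\<close>

lemma max_neg_def_graph:
  assumes "neg_def_subspace (graph X)"
  shows "max_neg_def_subspace (graph X)"
  unfolding max_neg_def_subspace_def
proof (intro conjI allI impI, fact, elim conjE)
  fix W' assume W': "neg_def_subspace W'" "graph X \<subseteq> W'"
  have "x \<in> graph X" if "x \<in> W'" for x
    using neg_def_inj_proj[OF W'(1) that, of "(X (snd x), snd x)"] W'(2) by (force simp: graph_def)
  then show "W' = graph X" using W'(2) by blast
qed

lemma dot_transpose_map:
  assumes "X \<in> finitary_maps"
  shows "dot (transpose_map X y) w = dot y (X w)"
proof -
  have lin: "linear X" using assms by (simp add: finitary_maps_def)
  \<comment> \<open>\<open>J\<close> is the index set of the sum defining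
    \<open>transpose_map\<close>; enlarged by the support of \<open>w\<close> it gives one finite
    set on which both sides are sums.\<close>
  define J where "J = {j. \<exists>i. entry X i j \<noteq> 0}"
  have "J = snd ` {(i, j). entry X i j \<noteq> 0}" by (force simp: J_def)
  then have fin: "finite J" using assms by (simp add: finitary_maps_def)
  define K where "K = J \<union> Poly_Mapping.keys w"
  have K: "finite K" "J \<subseteq> K" "Poly_Mapping.keys w \<subseteq> K" using fin by (auto simp: K_def)
  let ?s = "\<lambda>j. \<Sum>i\<in>Poly_Mapping.keys y. entry X i j * Poly_Mapping.lookup y i"
  have s0: "?s j = 0" if "j \<notin> J" for j
    using that by (intro sum.neutral) (auto simp: J_def)
  have lk: "Poly_Mapping.lookup (transpose_map X y) j = ?s j" for j
  proof -
    have "Poly_Mapping.lookup (transpose_map X y) j = (\<Sum>k\<in>J. if k = j then ?s k else 0)"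
      unfolding transpose_map_def J_def[symmetric] lookup_sum
      by (rule sum.cong) (auto simp: lookup_single when_def)
    then show ?thesis using fin s0 by (simp add: sum.delta)
  qed
  have "dot (transpose_map X y) w = (\<Sum>j\<in>K. ?s j * Poly_Mapping.lookup w j)"
    using dot_eq_sum[OF K(1), of "transpose_map X y" w] K(3) by (simp add: lk)
  also have "\<dots> = (\<Sum>i\<in>Poly_Mapping.keys y. Poly_Mapping.lookup y i * (\<Sum>j\<in>K. Poly_Mapping.lookup w j * entry X i j))"
    by (simp add: sum_distrib_left sum_distrib_right mult_ac) (rule sum.swap)
  also have "\<dots> = dot y (X w)"
    unfolding dot_def using linear_expansion[OF lin K(1,3)]
    by (simp add: lookup_sum entry_def)
  finally show ?thesis .
qed

text \<open>By adjointness the pairing of \<open>v - transpose_map X (X v)\<close> with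
  \<open>w\<close> is \<open>dot v w - dot (X v) (X w)\<close>. This is symmetric in
  \<open>v\<close> and \<open>w\<close>, and its positivity for \<open>w = v\<close> is strict
  contraction.\<close>

lemma bounded_realization_iff:
  "X \<in> bounded_realization \<longleftrightarrow> X \<in> finitary_maps \<and> strict_contraction X"
proof (cases "X \<in> finitary_maps")
  case True
  have left: "dot (v - transpose_map X (X v)) w = dot v w - dot (X v) (X w)" for v w
    by (simp add: dot_diff_left dot_transpose_map[OF True])
  have right: "dot v (w - transpose_map X (X w)) = dot v w - dot (X v) (X w)" for v w
    using left[of w v] by (simp only: dot_commute)
  show ?thesis
    using True
    by (simp add: bounded_realization_def pos_def_map_def strict_contraction_def left right)
qed (simp add: bounded_realization_def)


subsection \<open>Images of the negative space\<close>

text \<open>The matrix condition of \<open>SL_level\<close>, separated from the determinant so that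
  it can be applied to composites such as \<open>g \<circ> shear X\<close>.\<close>

definition identity_off :: "(nat + 'q) set \<Rightarrow> ('q V \<Rightarrow> 'q V) \<Rightarrow> bool" where
  "identity_off S h \<longleftrightarrow>
     (\<forall>i j. i \<notin> S \<or> j \<notin> S \<longrightarrow> mat_entry h i j = (if i = j then 1 else 0))"

text \<open>A moved basis vector may be sent to coordinates outside \<open>moved h\<close>; adding
  the supports of these finitely many images makes both the rows and the columns outside the set
  trivial.\<close>

lemma identity_off_ex:
  assumes "finite (moved h)"
  obtains S where "finite S" "identity_off S h"
proof
  let ?c = "\<lambda>j. {i. coord (h (basis j)) i \<noteq> 0}"
  let ?S = "moved h \<union> (\<Union>j\<in>moved h. ?c j)"
  have fin: "finite {i. coord x i \<noteq> 0}" for x :: "'a V"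
  proof -
    have "{i. coord x i \<noteq> 0} \<subseteq> Inl ` Poly_Mapping.keys (fst x) \<union> Inr ` Poly_Mapping.keys (snd x)"
    proof
      fix i assume "i \<in> {i. coord x i \<noteq> 0}"
      then show "i \<in> Inl ` Poly_Mapping.keys (fst x) \<union> Inr ` Poly_Mapping.keys (snd x)"
        by (cases i) (auto simp: in_keys_iff)
    qed
    then show ?thesis by (rule finite_subset) simp
  qed
  show "finite ?S" using assms fin by blast
  show "identity_off ?S h"
    unfolding identity_off_def
  proof (intro allI impI)
    fix i j assume ij: "i \<notin> ?S \<or> j \<notin> ?S"
    show "mat_entry h i j = (if i = j then 1 else 0)"
    proof (cases "j \<in> moved h")
      case True
      then show ?thesis using ij by (auto simp: mat_entry_def)
    next
      case False
      then show ?thesis by (simp add: moved_def mat_entry_def coord_basis)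
    qed
  qed
qed

lemma linear_blocks:
  assumes "linear h"
  shows "linear (block_A h)" "linear (block_B h)" "linear (block_C h)" "linear (block_D h)"
proof -
  have *: "h (x + y, 0) = h (x, 0) + h (y, 0)" "h (0, u + v) = h (0, u) + h (0, v)"
    "h (c *\<^sub>R x, 0) = c *\<^sub>R h (x, 0)" "h (0, c *\<^sub>R u) = c *\<^sub>R h (0, u)" for x y u v c
    using assms by (simp_all flip: linear_add linear_scale)
  show "linear (block_A h)" "linear (block_B h)" "linear (block_C h)" "linear (block_D h)"
    by (rule linearI; simp add: block_A_def block_B_def block_C_def block_D_def *)+
qed

text \<open>The coordinate at \<open>j\<close> vanishes on the span of the other basis vectors but
  not on the \<open>j\<close>-th one.\<close>

lemma independent_singles: "independent ((\<lambda>j. Poly_Mapping.single j (1::real)) ` J)"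
  unfolding dependent_def
proof
  assume "\<exists>a\<in>(\<lambda>j. Poly_Mapping.single j (1::real)) ` J.
      a \<in> span ((\<lambda>j. Poly_Mapping.single j 1) ` J - {a})"
  then obtain j where j: "Poly_Mapping.single j (1::real)
      \<in> span ((\<lambda>j. Poly_Mapping.single j 1) ` J - {Poly_Mapping.single j 1})" by auto
  have "subspace {v :: 'a \<Rightarrow>\<^sub>0 real. Poly_Mapping.lookup v j = 0}"
    by (rule subspaceI) (auto simp: lookup_add)
  then have "span ((\<lambda>j. Poly_Mapping.single j (1::real)) ` J - {Poly_Mapping.single j 1})
      \<subseteq> {v. Poly_Mapping.lookup v j = 0}"
    by (intro span_minimal) (auto simp: lookup_single when_def)
  with j show False by (auto simp: lookup_single)
qed

text \<open>The dimension count: the basis vectors indexed by \<open>J\<close> are sent to equally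
  many independent vectors in their own finite-dimensional span, so the images span it. The other
  basis vectors are fixed.\<close>

lemma surj_of_inj_identity_off:
  fixes T :: "('i \<Rightarrow>\<^sub>0 real) \<Rightarrow> ('i \<Rightarrow>\<^sub>0 real)"
  assumes lin: "linear T" and inj: "inj T" and fin: "finite J"
    and off: "\<And>j. j \<notin> J \<Longrightarrow> T (Poly_Mapping.single j 1) = Poly_Mapping.single j 1"
    and on: "\<And>j. j \<in> J \<Longrightarrow> Poly_Mapping.keys (T (Poly_Mapping.single j 1)) \<subseteq> J"
  shows "surj T"
proof -
  let ?e = "\<lambda>j. Poly_Mapping.single j (1::real)"
  let ?B = "?e ` J"
  have span_B: "v \<in> span ?B" if "Poly_Mapping.keys v \<subseteq> J" for v
  proof -
    have "v = (\<Sum>j\<in>J. Poly_Mapping.lookup v j *\<^sub>R ?e j)"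
      by (rule poly_mapping_expansion[OF fin that])
    also have "\<dots> \<in> span ?B"
      by (intro span_sum span_scale span_base) auto
    finally show ?thesis .
  qed
  have indep: "independent (T ` ?B)"
    by (rule linear_independent_injective_image[OF lin independent_singles])
      (rule inj_on_subset[OF inj], simp)
  have sub_B: "T ` ?B \<subseteq> span ?B"
    using on span_B by blast
  have card: "card (T ` ?B) = card ?B" by (rule card_image) (rule inj_on_subset[OF inj], simp)
  have "?B \<subseteq> span (T ` ?B)"
  proof (rule ccontr)
    assume "\<not> ?B \<subseteq> span (T ` ?B)"
    \<comment> \<open>A basis vector outside the span of the images would give one more independent
      vector than the span of \<open>?B\<close> can hold.\<close>
    then obtain b where b: "b \<in> ?B" "b \<notin> span (T ` ?B)" by blast
    then have ins: "independent (insert b (T ` ?B))" using indep by (simp add: independent_insert)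
    have "insert b (T ` ?B) \<subseteq> span ?B" using sub_B span_base[OF b(1)] by blast
    then have "card (insert b (T ` ?B)) \<le> card ?B"
      using independent_span_bound[OF finite_imageI[OF fin] ins] by simp
    moreover have "b \<notin> T ` ?B" using b(2) span_base[of b "T ` ?B"] by argo
    ultimately show False using fin card by simp
  qed
  then have "?B \<subseteq> T ` span ?B"
    using linear_span_image[OF lin, of ?B] by simp
  then have "?B \<subseteq> range T" by blast
  then have e: "?e j \<in> range T" for j
  proof (cases "j \<in> J")
    case False
    then have "?e j = T (?e j)" by (simp add: off)
    then show ?thesis by (rule range_eqI)
  qed blast
  have sub: "subspace (range T)" by (simp add: linear_subspace_image lin)
  have "v \<in> range T" for v
    by (subst poly_mapping_expansion[OF finite_keys order_refl, of v])
      (intro subspace_sum[OF sub] subspace_scale[OF sub e])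
  then show ?thesis by blast
qed

section \<open>Blocks of a map that is the identity off a finite set\<close>

lemma
  assumes "linear h"
  shows lookup_block_B: "Poly_Mapping.lookup (block_B h v) i
      = (\<Sum>j\<in>Poly_Mapping.keys v. Poly_Mapping.lookup v j * mat_entry h (Inl i) (Inr j))"
    and lookup_block_D: "Poly_Mapping.lookup (block_D h v) k
      = (\<Sum>j\<in>Poly_Mapping.keys v. Poly_Mapping.lookup v j * mat_entry h (Inr k) (Inr j))"
  by (subst linear_expansion[OF linear_blocks(2)[OF assms] finite_keys order_refl]
      linear_expansion[OF linear_blocks(4)[OF assms] finite_keys order_refl],
      simp add: lookup_sum block_B_def block_D_def mat_entry_def)+

lemma
  assumes "linear h" "identity_off S h"
  shows block_D_single_off: "Inr j \<notin> S \<Longrightarrow> block_D h (Poly_Mapping.single j 1) = Poly_Mapping.single j 1"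
    and block_B_single_off: "Inr j \<notin> S \<Longrightarrow> block_B h (Poly_Mapping.single j 1) = 0"
    and lookup_block_B_off: "Inl i \<notin> S \<Longrightarrow> Poly_Mapping.lookup (block_B h v) i = 0"
    and lookup_block_D_off: "Inr k \<notin> S \<Longrightarrow> Poly_Mapping.lookup (block_D h v) k = Poly_Mapping.lookup v k"
proof -
  have ent: "mat_entry h i j = (if i = j then 1 else 0)" if "i \<notin> S \<or> j \<notin> S" for i j
    using assms(2) that unfolding identity_off_def by blast
  show "block_D h (Poly_Mapping.single j 1) = Poly_Mapping.single j 1" if "Inr j \<notin> S"
    by (rule lookup_eqI) (simp add: lookup_block_D[OF assms(1)] ent that lookup_single when_def)
  show "block_B h (Poly_Mapping.single j 1) = 0" if "Inr j \<notin> S"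
    by (rule lookup_eqI) (simp add: lookup_block_B[OF assms(1)] ent that)
  show "Poly_Mapping.lookup (block_B h v) i = 0" if "Inl i \<notin> S"
    by (simp add: lookup_block_B[OF assms(1)] ent that)
  show "Poly_Mapping.lookup (block_D h v) k = Poly_Mapping.lookup v k" if "Inr k \<notin> S"
  proof -
    have "Poly_Mapping.lookup (block_D h v) k
        = (\<Sum>j\<in>Poly_Mapping.keys v. if j = k then Poly_Mapping.lookup v j else 0)"
      unfolding lookup_block_D[OF assms(1)] using that by (intro sum.cong) (auto simp: ent)
    also have "\<dots> = Poly_Mapping.lookup v k" by (auto simp: sum.delta in_keys_iff)
    finally show ?thesis .
  qed
qed

lemma h_zero_blocks: "h (0, v) = (block_B h v, block_D h v)"
  by (simp add: block_B_def block_D_def)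

text \<open>Negative definiteness makes \<pi>_- injective on the image, hence
  \<open>block_D h\<close> injective, and the dimension count makes it bijective. The image consists
  of the points \<open>(block_B h v, block_D h v)\<close>, so it is a graph over
  \<open>block_D h v\<close>. The last assertion keeps the support of the quotient within the
  coordinates of \<open>S\<close>, as continuity on a fixed level requires.\<close>

lemma
  assumes lin: "linear h" and inj: "inj h" and fin: "finite S" and off: "identity_off S h"
    and neg: "neg_def_subspace (h ` Vminus_space)"
  shows bij_block_D: "bij (block_D h)"
    and image_Vminus_eq_graph: "h ` Vminus_space = graph (block_B h \<circ> inv (block_D h))"
    and block_quotient_in_bounded_realization:
      "block_B h \<circ> inv (block_D h) \<in> bounded_realization"
    and block_quotient_in_level:
      "block_B h \<circ> inv (block_D h) \<in> finitary_level (Inl -` S, Inr -` S)"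
proof -
  let ?X = "block_B h \<circ> inv (block_D h)"
  have inj_D: "inj (block_D h)"
  proof (rule injI)
    fix v w assume "block_D h v = block_D h w"
    then have "h (0, v) = h (0, w)"
      by (intro neg_def_inj_proj[OF neg]) (auto simp: image_Vminus_space block_D_def)
    then show "v = w" using inj by (auto dest: Fun.injD)
  qed
  have "surj (block_D h)"
  proof (rule surj_of_inj_identity_off[OF linear_blocks(4)[OF lin] inj_D])
    show "finite (Inr -` S)" using fin by (simp add: finite_vimageI)
    show "block_D h (Poly_Mapping.single j 1) = Poly_Mapping.single j 1" if "j \<notin> Inr -` S" for j
      using block_D_single_off[OF lin off] that by simp
    show "Poly_Mapping.keys (block_D h (Poly_Mapping.single j 1)) \<subseteq> Inr -` S" if "j \<in> Inr -` S" for j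
      using lookup_block_D_off[OF lin off, where v = "Poly_Mapping.single j 1"] that
      by (fastforce simp: in_keys_iff lookup_single when_def split: if_splits)
  qed
  with inj_D show bij: "bij (block_D h)" by (simp add: bij_def)
  have linX: "linear ?X"
    by (rule linear_compose[OF linear_inv_bij[OF linear_blocks(4)[OF lin] bij] linear_blocks(2)[OF lin]])
  have entX: "entry ?X i j \<noteq> 0 \<Longrightarrow> Inl i \<in> S \<and> Inr j \<in> S" for i j
  proof (rule ccontr)
    assume e: "entry ?X i j \<noteq> 0" and "\<not> (Inl i \<in> S \<and> Inr j \<in> S)"
    then consider "Inl i \<notin> S" | "Inr j \<notin> S" by blast
    then show False
    proof cases
      case 1
      then show False using e lookup_block_B_off[OF lin off] by (simp add: entry_def)
    next
      case 2
      \<comment> \<open>Off \<open>S\<close> the block \<open>block_D h\<close> fixes the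
        \<open>j\<close>-th basis vector, so its inverse does too, and \<open>block_B h\<close>
        kills that vector.\<close>
      then have "inv (block_D h) (Poly_Mapping.single j 1) = Poly_Mapping.single j 1"
        using block_D_single_off[OF lin off] inj_D by (metis inv_f_f)
      then show False using e 2 block_B_single_off[OF lin off] by (simp add: entry_def)
    qed
  qed
  have "{(i, j). entry ?X i j \<noteq> 0} \<subseteq> Inl -` S \<times> Inr -` S" using entX by auto
  then have "finite {(i, j). entry ?X i j \<noteq> 0}"
    by (rule finite_subset) (simp add: fin finite_vimageI)
  with linX have X: "?X \<in> finitary_maps" by (simp add: finitary_maps_def)
  then show "?X \<in> finitary_level (Inl -` S, Inr -` S)"
    using entX by (auto simp: finitary_level_def)
  show gr: "h ` Vminus_space = graph ?X"
  proof -
    \<comment> \<open>Substitute \<open>w = block_D h v\<close>, which runs through all of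
      (V_0)_-.\<close>
    have "graph ?X = (\<lambda>w. (?X w, w)) ` range (block_D h)"
      using bij by (simp add: graph_def bij_is_surj)
    also have "\<dots> = h ` Vminus_space"
      using inj_D by (simp add: image_Vminus_space image_image h_zero_blocks)
    finally show ?thesis ..
  qed
  show "?X \<in> bounded_realization"
    using X neg gr neg_def_graph_iff[OF linX] by (simp add: bounded_realization_iff)
qed

lemma
  assumes "g \<in> SL"
  shows SL_linear: "linear g" and SL_bij: "bij g" and SL_finite_moved: "finite (moved g)"
  using assms by (simp_all add: SL_def)

lemma graph_flag_in_D0:
  assumes "X \<in> bounded_realization"
  shows "graph_flag X \<in> D0"
proof -
  have X: "X \<in> finitary_maps" "strict_contraction X" "linear X"
    using assms by (simp_all add: bounded_realization_iff finitary_maps_def)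
  have "graph_flag X \<in> flag_manifold"
    unfolding flag_manifold_def graph_flag_eq_shear[OF X(3)] using shear_in_SL[OF X(1)] by blast
  then show ?thesis
    using max_neg_def_graph[of X] X by (simp add: D0_def graph_flag_def neg_def_graph_iff)
qed

text \<open>Finiteness of \<open>moved g\<close> stands in for membership in \<open>SL\<close>, so
  that a composite with a shear is covered without computing its determinant. That the flag belongs
  to the flag manifold comes from the shear of the quotient map.\<close>

lemma
  assumes g: "linear g" "bij g" "finite (moved g)" and neg: "neg_def_subspace (g ` Vminus_space)"
  shows flag_act_base_in_D0: "flag_act g base_flag \<in> D0"
    and flag_map_flag_act_base: "flag_map (flag_act g base_flag) = block_B g \<circ> inv (block_D g)"
    and flag_map_flag_act_base_in: "flag_map (flag_act g base_flag) \<in> bounded_realization"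
    and bij_block_D_neg_def: "bij (block_D g)"
    and flag_act_base_eq_graph_flag:
      "flag_act g base_flag = graph_flag (flag_map (flag_act g base_flag))"
proof -
  obtain S where S: "finite S" "identity_off S g" using identity_off_ex[OF g(3)] .
  note * = g(1) bij_is_inj[OF g(2)] S neg
  have eq: "flag_act g base_flag = graph_flag (block_B g \<circ> inv (block_D g))"
    by (simp add: flag_act_base[OF g(1,2)] graph_flag_def image_Vminus_eq_graph[OF *])
  show m: "flag_map (flag_act g base_flag) = block_B g \<circ> inv (block_D g)"
    by (simp add: eq)
  show "flag_map (flag_act g base_flag) \<in> bounded_realization"
    unfolding m by (rule block_quotient_in_bounded_realization[OF *])
  show "flag_act g base_flag \<in> D0"
    unfolding eq by (rule graph_flag_in_D0[OF block_quotient_in_bounded_realization[OF *]])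
  show "bij (block_D g)" by (rule bij_block_D[OF *])
  show "flag_act g base_flag = graph_flag (flag_map (flag_act g base_flag))"
    unfolding m by (rule eq)
qed

text \<open>A negative definite subspace of this kind is a graph and therefore already
  maximal.\<close>

lemma flag_act_base_in_D0_iff:
  assumes "linear g" "bij g" "finite (moved g)"
  shows "flag_act g base_flag \<in> D0 \<longleftrightarrow> neg_def_subspace (g ` Vminus_space)"
  using flag_act_base_in_D0[OF assms]
  by (auto simp: flag_act_base[OF assms(1,2)] D0_def max_neg_def_subspace_def)

text \<open>The parametrization through which every later statement about \<open>D0\<close> becomes
  one about contractions.\<close>

lemma D0_eq: "D0 = graph_flag ` bounded_realization" (is "?D = ?G")
proof
  show "?G \<subseteq> ?D" using graph_flag_in_D0 by blast
  show "?D \<subseteq> ?G"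
  proof
    fix f :: "'a flag" assume f: "f \<in> ?D"
    then obtain g where g: "g \<in> SL" "f = flag_act g base_flag"
      by (auto simp: D0_def flag_manifold_def)
    note * = SL_linear[OF g(1)] SL_bij[OF g(1)] SL_finite_moved[OF g(1)]
    have "neg_def_subspace (g ` Vminus_space)"
      using f flag_act_base_in_D0_iff[OF *] by (simp add: g(2))
    from flag_act_base_eq_graph_flag[OF * this] flag_map_flag_act_base_in[OF * this]
    show "f \<in> ?G" unfolding g(2) by (rule image_eqI)
  qed
qed

section \<open>The bijection and the norm bound\<close>

lemma bij_betw_flag_map: "bij_betw flag_map D0 bounded_realization"
  unfolding D0_eq by (rule bij_betw_byWitness[where f' = graph_flag]) auto

lemma bounded_maps_bounded_realization: "bounded_maps bounded_realization"
  unfolding bounded_maps_def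
\<comment> \<open>Strict contractions have operator norm at most 1.\<close>
proof (intro exI[of _ 1] ballI allI)
  fix X :: "'a Vminus \<Rightarrow> Vplus" and v
  assume "X \<in> bounded_realization"
  then have "linear X" "strict_contraction X"
    by (simp_all add: bounded_realization_iff finitary_maps_def)
  then show "sqrt (dot (X v) (X v)) \<le> 1 * sqrt (dot v v)"
    by (cases "v = 0") (auto simp: linear_0 strict_contraction_def less_imp_le)
qed


subsection \<open>The action of the real group\<close>

text \<open>The component of \<open>id\<close> lies in the underlying set of its subspace topology,
  the isometries in \<open>SL\<close>.\<close>

lemma G0_isometry: "g \<in> G0 \<Longrightarrow> g \<in> SL \<and> (\<forall>x y. form_b (g x) (g y) = form_b x y)"
  unfolding G0_def
  using connected_component_of_subset_topspace[of "subtopology SL_topology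
      {g \<in> SL. \<forall>x y. form_b (g x) (g y) = form_b x y}" id]
  by auto

text \<open>The graph of \<open>X\<close> is the image of (V_0)_- under the shear of
  \<open>X\<close>. For \<open>h = g \<circ> shear X\<close> the blocks on (V_0)_- are
  \<open>AX + B\<close> and \<open>CX + D\<close>, so the quotient of blocks that describes
  \<open>h\<close> applied to the base point is the fractional linear formula.\<close>

lemma G0_action:
  assumes g: "g \<in> SL" "\<And>x y. form_b (g x) (g y) = form_b x y" and X: "X \<in> bounded_realization"
  shows "flag_act g (graph_flag X) \<in> D0"
    and "bij (\<lambda>v. block_C g (X v) + block_D g v)"
    and "flag_map (flag_act g (graph_flag X))
      = (\<lambda>v. block_A g (X v) + block_B g v) \<circ> inv (\<lambda>v. block_C g (X v) + block_D g v)"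
proof -
  have fin: "X \<in> finitary_maps" and lin: "linear X" and neg: "neg_def_subspace (graph X)"
    using X by (auto simp: bounded_realization_iff finitary_maps_def neg_def_graph_iff)
  note g' = SL_linear[OF g(1)] SL_bij[OF g(1)] SL_finite_moved[OF g(1)]
  let ?h = "g \<circ> shear X"
  have h1: "linear ?h" by (rule linear_compose[OF linear_shear[OF lin] g'(1)])
  have h2: "bij ?h" by (rule bij_comp[OF bij_shear g'(2)])
  have "moved ?h \<subseteq> moved g \<union> moved (shear X)" by (auto simp: moved_def)
  then have h3: "finite (moved ?h)"
    using g'(3) finite_moved_shear[OF fin] by (meson finite_UnI finite_subset)
  have img: "?h ` Vminus_space = g ` graph X" by (simp add: graph_eq_shear image_comp)
  \<comment> \<open>\<open>g\<close> preserves the form and so carries the negative definite graph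
    to a negative definite subspace.\<close>
  have h4: "neg_def_subspace (?h ` Vminus_space)"
    unfolding img neg_def_subspace_def
  proof (intro conjI ballI impI)
    show "subspace (g ` graph X)"
      by (rule linear_subspace_image[OF g'(1) subspace_graph[OF lin]])
    fix x assume "x \<in> g ` graph X" "x \<noteq> 0"
    then show "form_b x x < 0"
      using neg g(2) linear_0[OF g'(1)] by (auto simp: neg_def_subspace_def)
  qed
  have act: "flag_act ?h base_flag = flag_act g (graph_flag X)"
    by (simp add: graph_flag_eq_shear[OF lin] base_flag_def image_comp)
  have split: "g (X v, v) = g (X v, 0) + g (0, v)" for v
    by (simp flip: linear_add[OF g'(1)])
  have BD: "block_B ?h = (\<lambda>v. block_A g (X v) + block_B g v)"
    "block_D ?h = (\<lambda>v. block_C g (X v) + block_D g v)"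
    by (simp_all add: fun_eq_iff block_A_def block_B_def block_C_def block_D_def shear_def split)
  show "flag_act g (graph_flag X) \<in> D0"
    using flag_act_base_in_D0[OF h1 h2 h3 h4] by (simp add: act)
  show "bij (\<lambda>v. block_C g (X v) + block_D g v)"
    using bij_block_D_neg_def[OF h1 h2 h3 h4] by (simp add: BD)
  show "flag_map (flag_act g (graph_flag X))
      = (\<lambda>v. block_A g (X v) + block_B g v) \<circ> inv (\<lambda>v. block_C g (X v) + block_D g v)"
    using flag_map_flag_act_base[OF h1 h2 h3 h4] by (simp add: act BD)
qed

lemma D0_graph:
  assumes "({0}, F1, UNIV) \<in> D0"
  shows "bij_betw proj_minus F1 UNIV"
    and "x \<in> F1 \<Longrightarrow> flag_map ({0}, F1, UNIV) (proj_minus x) = proj_plus x"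
proof -
  obtain X where X: "({0}, F1, UNIV) = graph_flag X" using assms by (auto simp: D0_eq)
  then have F1: "F1 = graph X" by (simp add: graph_flag_def)
  show "bij_betw proj_minus F1 UNIV"
    unfolding F1 by (rule bij_betw_byWitness[where f' = "\<lambda>v. (X v, v)"]) (auto simp: graph_def)
  show "flag_map ({0}, F1, UNIV) (proj_minus x) = proj_plus x" if "x \<in> F1"
    unfolding X using that by (auto simp: F1 graph_def)
qed


subsection \<open>Direct limits, quotients and matrix entries\<close>

lemma topspace_direct_limit_topology:
  "topspace (direct_limit_topology I T) = (\<Union>i\<in>I. topspace (T i))"
proof
  show "topspace (direct_limit_topology I T) \<subseteq> (\<Union>i\<in>I. topspace (T i))"
    using openin_topspace[of "direct_limit_topology I T"] by (simp only: openin_direct_limit_topology)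
  have "(\<Union>i\<in>I. topspace (T i)) \<inter> topspace (T i) = topspace (T i)" if "i \<in> I" for i
    using that by blast
  then have "openin (direct_limit_topology I T) (\<Union>i\<in>I. topspace (T i))"
    by (simp add: openin_direct_limit_topology)
  then show "(\<Union>i\<in>I. topspace (T i)) \<subseteq> topspace (direct_limit_topology I T)"
    by (rule openin_subset)
qed

lemma continuous_map_into_direct_limit:
  assumes "i \<in> I" "continuous_map X (T i) f"
  shows "continuous_map X (direct_limit_topology I T) f"
  unfolding continuous_map_def
proof (intro conjI allI impI)
  have f: "f \<in> topspace X \<rightarrow> topspace (T i)" using assms(2) by (rule continuous_map_funspace)
  then show "f \<in> topspace X \<rightarrow> topspace (direct_limit_topology I T)"
    using assms(1) by (auto simp: topspace_direct_limit_topology)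
  fix U assume "openin (direct_limit_topology I T) U"
  then have "openin (T i) (U \<inter> topspace (T i))"
    using assms(1) by (simp add: openin_direct_limit_topology)
  from openin_continuous_map_preimage[OF assms(2) this]
  have "openin X {x \<in> topspace X. f x \<in> U \<inter> topspace (T i)}" .
  moreover have "{x \<in> topspace X. f x \<in> U \<inter> topspace (T i)} = {x \<in> topspace X. f x \<in> U}"
    using f by blast
  ultimately show "openin X {x \<in> topspace X. f x \<in> U}" by simp
qed

lemma continuous_map_from_direct_limit:
  assumes "\<And>i. i \<in> I \<Longrightarrow> continuous_map (T i) Y f"
  shows "continuous_map (direct_limit_topology I T) Y f"
  unfolding continuous_map_def
proof (intro conjI allI impI)
  show "f \<in> topspace (direct_limit_topology I T) \<rightarrow> topspace Y"
    using assms continuous_map_funspace by (fastforce simp: topspace_direct_limit_topology)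
  fix U assume U: "openin Y U"
  have "openin (T i) ({x \<in> topspace (direct_limit_topology I T). f x \<in> U} \<inter> topspace (T i))"
    if "i \<in> I" for i
  proof -
    have "{x \<in> topspace (direct_limit_topology I T). f x \<in> U} \<inter> topspace (T i)
        = {x \<in> topspace (T i). f x \<in> U}"
      using that by (auto simp: topspace_direct_limit_topology)
    then show ?thesis using openin_continuous_map_preimage[OF assms[OF that] U] by simp
  qed
  then show "openin (direct_limit_topology I T) {x \<in> topspace (direct_limit_topology I T). f x \<in> U}"
    by (auto simp: openin_direct_limit_topology topspace_direct_limit_topology)
qed

lemma topspace_quotient_topology: "topspace (quotient_topology T f) = f ` topspace T"
proof
  show "topspace (quotient_topology T f) \<subseteq> f ` topspace T"
    using openin_topspace[of "quotient_topology T f"] by (simp only: openin_quotient_topology)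
  have "{x \<in> topspace T. f x \<in> f ` topspace T} = topspace T" by blast
  then have "openin (quotient_topology T f) (f ` topspace T)"
    by (simp add: openin_quotient_topology)
  then show "f ` topspace T \<subseteq> topspace (quotient_topology T f)" by (rule openin_subset)
qed

lemma continuous_map_quotient_topology: "continuous_map T (quotient_topology T f) f"
  by (auto simp: continuous_map_def openin_quotient_topology topspace_quotient_topology)

text \<open>The topology on functions is the product topology; componentwise continuity is applied
  once for each index.\<close>

lemma continuous_map_matrix_iff:
  fixes F :: "'z \<Rightarrow> 'a \<Rightarrow> 'b \<Rightarrow> real"
  shows "continuous_map Z euclidean F \<longleftrightarrow> (\<forall>a b. continuous_map Z euclideanreal (\<lambda>z. F z a b))"
proof -
  have "continuous_map Z euclidean F \<longleftrightarrow> (\<forall>a. continuous_map Z euclidean (\<lambda>z. F z a))"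
    using continuous_map_componentwise_UNIV[of Z "\<lambda>_. euclidean" F]
    by (simp add: euclidean_product_topology)
  moreover have "continuous_map Z euclidean (\<lambda>z. F z a)
      \<longleftrightarrow> (\<forall>b. continuous_map Z euclideanreal (\<lambda>z. F z a b))" for a
    using continuous_map_componentwise_UNIV[of Z "\<lambda>_. euclidean" "\<lambda>z. F z a"]
    by (simp add: euclidean_product_topology)
  ultimately show ?thesis by simp
qed

lemma continuous_map_pullback_entry:
  fixes m :: "'z \<Rightarrow> 'a \<Rightarrow> 'b \<Rightarrow> real"
  shows "continuous_map (pullback_topology A m euclidean) euclideanreal (\<lambda>z. m z a b)"
proof -
  have "continuous_map (pullback_topology A m euclidean) euclidean (id \<circ> m)"
    by (rule continuous_map_pullback) simp
  then have "continuous_map (pullback_topology A m euclidean) euclidean m" by simp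
  then show ?thesis by (simp add: continuous_map_matrix_iff)
qed

lemma continuous_map_into_pullback:
  fixes m :: "'z \<Rightarrow> 'a \<Rightarrow> 'b \<Rightarrow> real"
  assumes "\<And>y. y \<in> topspace Y \<Longrightarrow> f y \<in> A"
    and "\<And>a b. continuous_map Y euclideanreal (\<lambda>y. m (f y) a b)"
  shows "continuous_map Y (pullback_topology A m euclidean) f"
  by (rule continuous_map_pullback') (use assms in \<open>auto simp: continuous_map_matrix_iff\<close>)

section \<open>Finite levels and underlying sets\<close>

lemma
  assumes "g \<in> SL_level S"
  shows SL_level_SL: "g \<in> SL" and SL_level_identity_off: "identity_off S g"
  using assms by (simp_all add: SL_level_def identity_off_def)

lemma SL_eq_Union: "SL = (\<Union>S\<in>{S. finite S}. SL_level S)"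
proof (rule equalityI; rule subsetI)
  fix g :: "'a V \<Rightarrow> 'a V"
  assume g: "g \<in> SL"
  obtain S where S: "finite S" "identity_off S g"
    using identity_off_ex[OF SL_finite_moved[OF g]] .
  have "g \<in> SL_level S" using g S(2) by (simp add: SL_level_def identity_off_def)
  then show "g \<in> (\<Union>S\<in>{S. finite S}. SL_level S)" using S(1) by blast
next
  fix g :: "'a V \<Rightarrow> 'a V"
  assume "g \<in> (\<Union>S\<in>{S. finite S}. SL_level S)"
  then show "g \<in> SL" by (elim UN_E) (rule SL_level_SL)
qed

lemma topspace_SL_topology: "topspace SL_topology = SL"
  unfolding SL_topology_def topspace_direct_limit_topology topspace_pullback_topology SL_eq_Union
  by simp

lemma finitary_maps_eq_Union:
  "finitary_maps = (\<Union>S\<in>{S. finite (fst S) \<and> finite (snd S)}. finitary_level S)"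
proof (rule equalityI; rule subsetI)
  fix X :: "'a Vminus \<Rightarrow> Vplus"
  assume "X \<in> finitary_maps"
  then obtain S where "finite (fst S)" "finite (snd S)" "X \<in> finitary_level S"
    by (rule finitary_support)
  then show "X \<in> (\<Union>S\<in>{S. finite (fst S) \<and> finite (snd S)}. finitary_level S)" by blast
next
  fix X :: "'a Vminus \<Rightarrow> Vplus"
  assume "X \<in> (\<Union>S\<in>{S. finite (fst S) \<and> finite (snd S)}. finitary_level S)"
  then show "X \<in> finitary_maps" by (elim UN_E) (simp add: finitary_level_def)
qed

lemma topspace_finitary_topology: "topspace finitary_topology = finitary_maps"
  unfolding finitary_topology_def topspace_direct_limit_topology topspace_pullback_topology
    finitary_maps_eq_Union
  by simp

lemma topspace_flag_topology: "topspace flag_topology = flag_manifold"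
  by (simp add: flag_topology_def topspace_quotient_topology topspace_SL_topology flag_manifold_def)

text \<open>Maps supported in \<open>S\<close> have their shears in one finite level of
  \<open>SL\<close>, and each matrix entry of the shear is either an entry of \<open>X\<close> or
  constant.\<close>

lemma continuous_map_shear: "continuous_map finitary_topology SL_topology shear"
  unfolding finitary_topology_def
proof (rule continuous_map_from_direct_limit)
  fix S :: "nat set \<times> 'a set" assume S: "S \<in> {S. finite (fst S) \<and> finite (snd S)}"
  let ?T = "pullback_topology (finitary_level S) entry euclidean"
  let ?S = "Inl ` fst S \<union> Inr ` snd S"
  have lvl: "X \<in> topspace ?T \<Longrightarrow> X \<in> finitary_level S" for X
    by (simp add: topspace_pullback_topology)
  have lin: "linear X" if "X \<in> topspace ?T" for X
    using lvl[OF that] by (simp add: finitary_level_def finitary_maps_def)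
  have "continuous_map ?T (pullback_topology (SL_level ?S) mat_entry euclidean) shear"
  proof (rule continuous_map_into_pullback)
    fix X assume X: "X \<in> topspace ?T"
    have "shear X \<in> SL" using lvl[OF X] by (simp add: finitary_level_def shear_in_SL)
    moreover have "mat_entry (shear X) i j = (if i = j then 1 else 0)" if "i \<notin> ?S \<or> j \<notin> ?S" for i j
    proof (cases i; cases j)
      fix m k assume [simp]: "i = Inl m" "j = Inr k"
      have "entry X m k = 0" using lvl[OF X] that by (auto simp: finitary_level_def)
      then show ?thesis by (simp add: mat_entry_shear[OF lin[OF X]])
    qed (simp_all add: mat_entry_shear[OF lin[OF X]])
    ultimately show "shear X \<in> SL_level ?S" unfolding SL_level_def by blast
  next
    fix i j :: "nat + 'a"
    show "continuous_map ?T euclideanreal (\<lambda>X. mat_entry (shear X) i j)"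
    proof (cases "\<exists>m k. i = Inl m \<and> j = Inr k")
      case True
      then obtain m k where ij: "i = Inl m" "j = Inr k" by blast
      have "entry X m k = mat_entry (shear X) i j" if "X \<in> topspace ?T" for X
        by (simp add: mat_entry_shear[OF lin[OF that]] ij)
      then show ?thesis
        by (rule continuous_map_eq[OF continuous_map_pullback_entry])
    next
      case False
      define c :: real where "c = (if i = j then 1 else 0)"
      have "c = mat_entry (shear X) i j" if "X \<in> topspace ?T" for X
        using False by (cases i; cases j) (simp_all add: c_def mat_entry_shear[OF lin[OF that]])
      moreover have "continuous_map ?T euclideanreal (\<lambda>X. c)" by simp
      ultimately show ?thesis by (metis (no_types, lifting) continuous_map_eq)
    qed
  qed
  then show "continuous_map ?T SL_topology shear"
    unfolding SL_topology_def
    by (rule continuous_map_into_direct_limit[rotated]) (use S in simp)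
qed

text \<open>\<open>graph_flag\<close> is \<open>shear\<close> followed by the orbit map, which is
  continuous for the quotient topology.\<close>

lemma continuous_map_graph_flag: "continuous_map finitary_topology flag_topology graph_flag"
proof -
  have "continuous_map finitary_topology flag_topology ((\<lambda>g. flag_act g base_flag) \<circ> shear)"
    unfolding flag_topology_def
    by (rule continuous_map_compose[OF continuous_map_shear continuous_map_quotient_topology])
  then show ?thesis
    by (rule continuous_map_eq)
      (simp add: topspace_finitary_topology finitary_maps_def graph_flag_eq_shear)
qed

text \<open>The set is star-shaped about the zero map. Each segment stays in one finite level, where
  its entries are linear in \<open>t\<close>, and all segments share the zero map.\<close>

lemma connectedin_bounded_realization: "connectedin finitary_topology bounded_realization"
proof -
  let ?seg = "\<lambda>X :: 'a Vminus \<Rightarrow> Vplus. (\<lambda>t v. t *\<^sub>R X v) ` {0..1::real}"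
  have scaled: "(\<lambda>v. t *\<^sub>R X v) \<in> finitary_level S" if "X \<in> finitary_level S" for X t S
  proof -
    have X: "linear X" "finite {(i, j). entry X i j \<noteq> 0}"
      using that by (auto simp: finitary_level_def finitary_maps_def)
    have ent: "entry (\<lambda>v. t *\<^sub>R X v) i j = t * entry X i j" for i j by (simp add: entry_def)
    have "linear (\<lambda>v. t *\<^sub>R X v)"
      using X(1) by (intro linearI) (auto simp: linear_add linear_scale algebra_simps)
    moreover have "finite {(i, j). entry (\<lambda>v. t *\<^sub>R X v) i j \<noteq> 0}"
      by (rule finite_subset[OF _ X(2)]) (auto simp: ent)
    ultimately show ?thesis using that by (auto simp: finitary_level_def finitary_maps_def ent)
  qed
  have conn: "connectedin finitary_topology (?seg X)" if X: "X \<in> bounded_realization" for X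
  proof -
    obtain S where S: "finite (fst S)" "finite (snd S)" "X \<in> finitary_level S"
      by (rule finitary_support[of X]) (use X in \<open>simp add: bounded_realization_iff\<close>)
    have "continuous_map euclideanreal (pullback_topology (finitary_level S) entry euclidean)
        (\<lambda>t v. t *\<^sub>R X v)"
    proof (rule continuous_map_into_pullback)
      show "continuous_map euclideanreal euclideanreal (\<lambda>t. entry (\<lambda>v. t *\<^sub>R X v) i j)" for i j
        by (simp add: entry_def) (intro continuous_intros)
    qed (rule scaled[OF S(3)])
    then have "continuous_map euclideanreal finitary_topology (\<lambda>t v. t *\<^sub>R X v)"
      unfolding finitary_topology_def
      by (rule continuous_map_into_direct_limit[rotated]) (use S in auto)
    then show ?thesis by (rule connectedin_continuous_map_image) simp
  qed
  have sub: "?seg X \<subseteq> bounded_realization" if X: "X \<in> bounded_realization" for X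
  proof clarify
    fix t :: real assume t: "t \<in> {0..1}"
    obtain S where "X \<in> finitary_level S"
      by (rule finitary_support[of X]) (use X in \<open>simp add: bounded_realization_iff\<close>)
    from scaled[OF this] have "(\<lambda>v. t *\<^sub>R X v) \<in> finitary_maps" by (simp add: finitary_level_def)
    moreover have "dot (t *\<^sub>R X v) (t *\<^sub>R X v) < dot v v" if "v \<noteq> 0" for v
    proof -
      have "dot (t *\<^sub>R X v) (t *\<^sub>R X v) \<le> 1 * dot (X v) (X v)"
        unfolding dot_scaleR using t by (intro mult_right_mono dot_self_nonneg) (simp add: power_le_one)
      also have "\<dots> < dot v v"
        using X that by (simp add: bounded_realization_iff strict_contraction_def)
      finally show ?thesis .
    qed
    ultimately show "(\<lambda>v. t *\<^sub>R X v) \<in> bounded_realization"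
      by (simp add: bounded_realization_iff strict_contraction_def)
  qed
  have "(\<lambda>v. 0) \<in> ?seg X" for X by (rule image_eqI[of _ _ 0]) auto
  then have "(\<lambda>v. 0) \<in> \<Inter> (?seg ` bounded_realization)" by (intro INT_I)
  then have "connectedin finitary_topology (\<Union> (?seg ` bounded_realization))"
    by (intro connectedin_Union) (auto intro: conn)
  moreover have "\<Union> (?seg ` bounded_realization) = bounded_realization"
  proof (rule equalityI)
    show "\<Union> (?seg ` bounded_realization) \<subseteq> bounded_realization"
      by (intro UN_least sub)
    show "bounded_realization \<subseteq> \<Union> (?seg ` bounded_realization)"
    proof
      fix X :: "'a Vminus \<Rightarrow> Vplus" assume X: "X \<in> bounded_realization"
      have "X \<in> ?seg X" by (rule image_eqI[of _ _ 1]) auto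
      with X show "X \<in> \<Union> (?seg ` bounded_realization)" by (rule UN_I[where B = ?seg])
    qed
  qed
  ultimately show ?thesis by simp
qed

lemma zero_in_bounded_realization: "(\<lambda>v. 0) \<in> bounded_realization"
proof -
  have "(\<lambda>v. 0) \<in> finitary_maps"
    by (simp add: finitary_maps_def entry_def linear_iff)
  then show ?thesis by (simp add: bounded_realization_iff strict_contraction_def dot_self_pos)
qed

subsection \<open>The domain is open\<close>

text \<open>The tube lemma: the open set where \<open>q\<close> is negative contains
  \<open>{M} \<times> K\<close>, hence \<open>U \<times> K\<close> for some neighbourhood
  \<open>U\<close> of \<open>M\<close>.\<close>

lemma open_forall_compact_less:
  fixes q :: "'a::topological_space \<Rightarrow> 'b::topological_space \<Rightarrow> real"
  assumes "compact K" and "continuous_on UNIV (\<lambda>(M, w). q M w)"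
  shows "open {M. \<forall>w\<in>K. q M w < 0}"
proof (subst open_subopen, intro ballI)
  fix M assume M: "M \<in> {M. \<forall>w\<in>K. q M w < 0}"
  let ?W = "{p. (\<lambda>(M, w). q M w) p < 0}"
  have "open ?W" by (rule open_Collect_less[OF assms(2)]) simp
  moreover have "{M} \<times> K \<subseteq> ?W" using M by auto
  ultimately obtain U where "M \<in> U" "open U" "U \<times> K \<subseteq> ?W"
    using Elementary_Topology.tube_lemma[OF assms(1)] by metis
  then show "\<exists>T. open T \<and> M \<in> T \<and> T \<subseteq> {M. \<forall>w\<in>K. q M w < 0}"
    by (intro exI[of _ U]) auto
qed

text \<open>Vectors are functions on the whole index type that vanish off \<open>N\<close>, so that
  compactness can be taken in the product topology.\<close>

definition unit_sphere :: "'q set \<Rightarrow> ('q \<Rightarrow> real) set" where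
  "unit_sphere N = {w. (\<forall>j. j \<notin> N \<longrightarrow> w j = 0) \<and> (\<Sum>j\<in>N. (w j)\<^sup>2) = 1}"

text \<open>A closed subset of a product of compact sets, with factor \<open>{0}\<close> at the
  indices outside \<open>N\<close>.\<close>

lemma compact_unit_sphere:
  fixes N :: "'q set"
  assumes "finite N"
  shows "compact (unit_sphere N)"
proof -
  let ?B = "\<lambda>j. if j \<in> N then {-1..1::real} else {0}"
  have "compactin (product_topology (\<lambda>_. euclideanreal) UNIV) (PiE UNIV ?B)"
    by (subst compactin_PiE) auto
  then have box: "compact (PiE (UNIV :: 'q set) ?B)"
    by (simp add: euclidean_product_topology)
  have "continuous_on UNIV (\<lambda>w::'q \<Rightarrow> real. \<Sum>j\<in>N. (w j)\<^sup>2)"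
    by (intro continuous_intros continuous_on_product_coordinates)
  then have cl: "closed {w::'q \<Rightarrow> real. (\<Sum>j\<in>N. (w j)\<^sup>2) = 1}"
    by (intro closed_Collect_eq) auto
  have "w j \<in> {-1..1}" if "w \<in> unit_sphere N" "j \<in> N" for w j
  proof -
    have "(w j)\<^sup>2 \<le> (\<Sum>j\<in>N. (w j)\<^sup>2)"
      by (rule member_le_sum) (use that assms in auto)
    also have "\<dots> = 1" using that by (simp add: unit_sphere_def)
    finally show ?thesis by (simp add: abs_square_le_1 abs_le_iff)
  qed
  then have "unit_sphere N = PiE UNIV ?B \<inter> {w. (\<Sum>j\<in>N. (w j)\<^sup>2) = 1}"
    by (auto simp: unit_sphere_def PiE_iff split: if_splits)
  then show ?thesis using compact_Int_closed[OF box cl] by simp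
qed

text \<open>The pullback of \<open>form_b\<close> to the part of (V_0)_- with coordinates in
  \<open>S\<close>, written for an arbitrary matrix \<open>M\<close> so that it is continuous on the
  whole matrix space.\<close>

definition level_form ::
    "(nat + 'q) set \<Rightarrow> (nat + 'q \<Rightarrow> nat + 'q \<Rightarrow> real) \<Rightarrow> ('q \<Rightarrow> real) \<Rightarrow> real" where
  "level_form S M w =
     (\<Sum>i\<in>Inl -` S. (\<Sum>j\<in>Inr -` S. M (Inl i) (Inr j) * w j)\<^sup>2)
     - (\<Sum>k\<in>Inr -` S. (\<Sum>j\<in>Inr -` S. M (Inr k) (Inr j) * w j)\<^sup>2)"

lemma continuous_on_level_form: "continuous_on UNIV (\<lambda>(M, w). level_form S M w)"
proof -
  have "continuous_on UNIV (\<lambda>p :: (nat + 'q \<Rightarrow> nat + 'q \<Rightarrow> real) \<times> ('q \<Rightarrow> real). fst p a b)" for a b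
    using continuous_on_product_then_coordinatewise[OF continuous_on_product_then_coordinatewise
        [OF continuous_on_fst[OF continuous_on_id]]] .
  moreover have "continuous_on UNIV (\<lambda>p :: (nat + 'q \<Rightarrow> nat + 'q \<Rightarrow> real) \<times> ('q \<Rightarrow> real). snd p b)" for b
    using continuous_on_product_then_coordinatewise[OF continuous_on_snd[OF continuous_on_id]] .
  ultimately show ?thesis
    unfolding level_form_def case_prod_unfold by (intro continuous_intros)
qed

lemma level_form_scale: "level_form S M (\<lambda>j. c * w j) = c\<^sup>2 * level_form S M w"
proof -
  have "(\<Sum>j\<in>N. M a (Inr j) * (c * w j))\<^sup>2 = c\<^sup>2 * (\<Sum>j\<in>N. M a (Inr j) * w j)\<^sup>2" for a and N :: "'a set"
    by (simp add: sum_distrib_left mult_ac flip: power_mult_distrib)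
  then show ?thesis
    by (simp add: level_form_def right_diff_distrib flip: sum_distrib_left)
qed

lemma level_form_cong:
  "(\<And>j. Inr j \<in> S \<Longrightarrow> w j = w' j) \<Longrightarrow> level_form S M w = level_form S M w'"
  by (simp add: level_form_def)

text \<open>Off \<open>S\<close> the map is the identity and does not mix with the coordinates in
  \<open>S\<close>, so each outside coordinate of \<open>v\<close> contributes minus its
  square.\<close>

lemma form_b_identity_off:
  assumes lin: "linear g" and S: "finite S" "identity_off S g"
  shows "form_b (g (0, v)) (g (0, v)) = level_form S (mat_entry g) (Poly_Mapping.lookup v)
      - (\<Sum>j\<in>Poly_Mapping.keys v - Inr -` S. (Poly_Mapping.lookup v j)\<^sup>2)"
proof -
  let ?v = "Poly_Mapping.lookup v"
  define P N where "P = (Inl -` S :: nat set)" and "N = Inr -` S"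
  have fin: "finite P" "finite N" using S(1) by (simp_all add: P_def N_def finite_vimageI)
  have restrict: "(\<Sum>j\<in>Poly_Mapping.keys v. ?v j * mat_entry g a (Inr j))
      = (\<Sum>j\<in>N. mat_entry g a (Inr j) * ?v j)" if a: "a \<in> S" for a
  proof -
    have zero: "mat_entry g a (Inr j) = 0" if "j \<notin> N" for j
    proof -
      have "Inr j \<notin> S" "a \<noteq> Inr j" using that a by (auto simp: N_def)
      then show ?thesis using S(2) by (simp add: identity_off_def)
    qed
    have "(\<Sum>j\<in>Poly_Mapping.keys v. ?v j * mat_entry g a (Inr j))
        = (\<Sum>j\<in>Poly_Mapping.keys v \<union> N. ?v j * mat_entry g a (Inr j))"
      by (rule sum.mono_neutral_left) (auto simp: fin in_keys_iff)
    also have "\<dots> = (\<Sum>j\<in>N. ?v j * mat_entry g a (Inr j))"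
      by (rule sum.mono_neutral_right) (auto simp: fin zero)
    finally show ?thesis by (simp add: mult.commute)
  qed
  have "Poly_Mapping.keys (block_B g v) \<subseteq> P"
    using lookup_block_B_off[OF lin S(2)] by (auto simp: in_keys_iff P_def)
  then have B: "dot (block_B g v) (block_B g v) = (\<Sum>i\<in>P. (\<Sum>j\<in>N. mat_entry g (Inl i) (Inr j) * ?v j)\<^sup>2)"
    using dot_eq_sum[OF fin(1), of "block_B g v" "block_B g v"]
    by (simp add: power2_eq_square lookup_block_B[OF lin] restrict P_def)
  have "Poly_Mapping.keys (block_D g v) \<subseteq> N \<union> (Poly_Mapping.keys v - N)"
  proof
    fix k assume "k \<in> Poly_Mapping.keys (block_D g v)"
    then show "k \<in> N \<union> (Poly_Mapping.keys v - N)"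
      by (cases "Inr k \<in> S") (simp_all add: in_keys_iff N_def lookup_block_D_off[OF lin S(2)])
  qed
  then have "dot (block_D g v) (block_D g v)
      = (\<Sum>k\<in>N \<union> (Poly_Mapping.keys v - N). (Poly_Mapping.lookup (block_D g v) k)\<^sup>2)"
    using dot_eq_sum[of "N \<union> (Poly_Mapping.keys v - N)" "block_D g v" "block_D g v"] fin
    by (simp add: power2_eq_square)
  also have "\<dots> = (\<Sum>k\<in>N. (Poly_Mapping.lookup (block_D g v) k)\<^sup>2)
      + (\<Sum>k\<in>Poly_Mapping.keys v - N. (Poly_Mapping.lookup (block_D g v) k)\<^sup>2)"
    by (rule sum.union_disjoint) (use fin in auto)
  also have "(\<Sum>k\<in>N. (Poly_Mapping.lookup (block_D g v) k)\<^sup>2)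
      = (\<Sum>k\<in>N. (\<Sum>j\<in>N. mat_entry g (Inr k) (Inr j) * ?v j)\<^sup>2)"
    by (rule sum.cong) (simp_all add: lookup_block_D[OF lin] restrict N_def)
  also have "(\<Sum>k\<in>Poly_Mapping.keys v - N. (Poly_Mapping.lookup (block_D g v) k)\<^sup>2)
      = (\<Sum>k\<in>Poly_Mapping.keys v - N. (?v k)\<^sup>2)"
    by (rule sum.cong) (use lookup_block_D_off[OF lin S(2)] in \<open>auto simp: N_def\<close>)
  finally show ?thesis
    by (simp add: form_b_def h_zero_blocks level_form_def B P_def N_def)
qed

text \<open>The coordinates outside \<open>S\<close> only lower the form, so its sign is decided on
  the coordinates in \<open>S\<close>, and by homogeneity on their unit sphere.\<close>

lemma neg_def_image_iff:
  assumes lin: "linear g" and inj: "inj g" and S: "finite S" "identity_off S g"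
  shows "neg_def_subspace (g ` Vminus_space)
    \<longleftrightarrow> (\<forall>w\<in>unit_sphere (Inr -` S). level_form S (mat_entry g) w < 0)"
proof -
  let ?N = "Inr -` S" and ?q = "level_form S (mat_entry g)"
  have finN: "finite ?N" using S(1) by (simp add: finite_vimageI)
  have sub: "subspace (g ` Vminus_space)"
    unfolding Vminus_space_def by (intro linear_subspace_image lin subspace_span)
  have "g (0, v) \<noteq> 0 \<longleftrightarrow> v \<noteq> 0" for v
    using linear_0[OF lin] injD[OF inj, of "(0, v)" 0] by (auto simp: zero_prod_def)
  then have "neg_def_subspace (g ` Vminus_space)
      \<longleftrightarrow> (\<forall>v. v \<noteq> 0 \<longrightarrow> form_b (g (0, v)) (g (0, v)) < 0)"
    using sub by (simp add: neg_def_subspace_def image_Vminus_space)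
  also have "\<dots> \<longleftrightarrow> (\<forall>w\<in>unit_sphere ?N. ?q w < 0)"
  proof (intro iffI allI ballI impI)
    fix w assume neg: "\<forall>v. v \<noteq> 0 \<longrightarrow> form_b (g (0, v)) (g (0, v)) < 0" and w: "w \<in> unit_sphere ?N"
    \<comment> \<open>\<open>w\<close> vanishes off a finite set and is thus the coordinate function
      of a vector, which has no coordinates outside \<open>S\<close>.\<close>
    define v where "v = Abs_poly_mapping w"
    have "{j. w j \<noteq> 0} \<subseteq> ?N" using w by (auto simp: unit_sphere_def)
    then have lk: "Poly_Mapping.lookup v = w"
      unfolding v_def using finN by (intro lookup_Abs_poly_mapping) (rule finite_subset)
    have keys: "Poly_Mapping.keys v - ?N = {}"
      using w by (auto simp: in_keys_iff lk unit_sphere_def)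
    have "v \<noteq> 0"
    proof
      assume "v = 0"
      then have "w = (\<lambda>_. 0)" using lk by auto
      then show False using w by (simp add: unit_sphere_def)
    qed
    with neg have "form_b (g (0, v)) (g (0, v)) < 0" by blast
    then show "?q w < 0"
      unfolding form_b_identity_off[OF lin S] lk keys by simp
  next
    fix v :: "'a Vminus"
    assume neg: "\<forall>w\<in>unit_sphere ?N. ?q w < 0" and v: "v \<noteq> 0"
    let ?v = "Poly_Mapping.lookup v"
    \<comment> \<open>\<open>s\<close> and \<open>r\<close> are the squared lengths of the parts of
      \<open>v\<close> inside and outside \<open>S\<close>.\<close>
    define s where "s = (\<Sum>j\<in>?N. (?v j)\<^sup>2)"
    define r where "r = (\<Sum>j\<in>Poly_Mapping.keys v - ?N. (?v j)\<^sup>2)"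
    have form: "form_b (g (0, v)) (g (0, v)) = ?q ?v - r"
      unfolding r_def by (rule form_b_identity_off[OF lin S])
    have r0: "0 \<le> r" by (simp add: r_def sum_nonneg)
    have s0: "0 \<le> s" by (simp add: s_def sum_nonneg)
    show "form_b (g (0, v)) (g (0, v)) < 0"
    proof (cases "s = 0")
      \<comment> \<open>Here \<open>v\<close> lies entirely outside \<open>S\<close>; the level form
        vanishes and negativity comes from \<open>r\<close>.\<close>
      case True
      then have vN: "?v j = 0" if "j \<in> ?N" for j
        using that finN by (simp add: s_def sum_nonneg_eq_0_iff)
      have "?q ?v = ?q (\<lambda>j. 0 * ?v j)" by (rule level_form_cong) (simp add: vN)
      then have q0: "?q ?v = 0" unfolding level_form_scale by simp
      have "Poly_Mapping.keys v \<noteq> {}" using v by simp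
      moreover have "Poly_Mapping.keys v \<inter> ?N = {}"
        using vN by (auto simp: in_keys_iff simp del: vimage_eq)
      ultimately have "Poly_Mapping.keys v - ?N \<noteq> {}" by blast
      then have "0 < r"
        unfolding r_def by (intro sum_pos) (auto simp: in_keys_iff)
      then show ?thesis by (simp add: form q0)
    next
      case False
      with s0 have s: "0 < s" by simp
      \<comment> \<open>The part of \<open>v\<close> in \<open>S\<close>, normalized to length
        1.\<close>
      define w where "w = (\<lambda>j. if j \<in> ?N then ?v j / sqrt s else 0)"
      have "(\<Sum>j\<in>?N. (w j)\<^sup>2) = s / s"
        unfolding s_def sum_divide_distrib
        by (rule sum.cong) (use s in \<open>simp_all add: w_def power_divide s_def\<close>)
      then have "w \<in> unit_sphere ?N" using s by (simp add: unit_sphere_def w_def)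
      then have "?q w < 0" using neg by blast
      moreover have "?q ?v = ?q (\<lambda>j. sqrt s * w j)"
        by (rule level_form_cong) (use s in \<open>simp add: w_def\<close>)
      then have "?q ?v = s * ?q w" unfolding level_form_scale using s by simp
      ultimately have "?q ?v < 0" using s by (simp add: mult_pos_neg)
      then show ?thesis using r0 by (simp add: form)
    qed
  qed
  finally show ?thesis .
qed

abbreviation SL_level_topology :: "(nat + 'q) set \<Rightarrow> ('q V \<Rightarrow> 'q V) topology" where
  "SL_level_topology S \<equiv> pullback_topology (SL_level S) mat_entry euclidean"

text \<open>The set is the preimage under \<open>mat_entry\<close> of the open set of matrices whose
  level form is negative on the compact unit sphere.\<close>

lemma openin_SL_level_D0:
  assumes S: "finite S"
  shows "openin (SL_level_topology S) {g \<in> SL_level S. flag_act g base_flag \<in> D0}"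
proof -
  let ?U = "{M. \<forall>w\<in>unit_sphere (Inr -` S). level_form S M w < 0}"
  have "open ?U"
    by (rule open_forall_compact_less[OF compact_unit_sphere continuous_on_level_form])
      (simp add: S finite_vimageI)
  moreover have "flag_act g base_flag \<in> D0 \<longleftrightarrow> mat_entry g \<in> ?U" if "g \<in> SL_level S" for g
  proof -
    note g = SL_level_SL[OF that]
    show ?thesis
      using flag_act_base_in_D0_iff[OF SL_linear[OF g] SL_bij[OF g] SL_finite_moved[OF g]]
        neg_def_image_iff[OF SL_linear[OF g] bij_is_inj[OF SL_bij[OF g]] S SL_level_identity_off[OF that]]
      by simp
  qed
  then have "{g \<in> SL_level S. flag_act g base_flag \<in> D0} = mat_entry -` ?U \<inter> SL_level S" by blast
  ultimately show ?thesis by (auto simp: openin_pullback_topology)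
qed

text \<open>Unfolds the quotient and the direct limit together, so that openness of a set of flags
  can be tested on one finite level at a time.\<close>

lemma openin_flag_topology_iff:
  "openin flag_topology W \<longleftrightarrow> W \<subseteq> flag_manifold
    \<and> (\<forall>S. finite S \<longrightarrow> openin (SL_level_topology S) {g \<in> SL_level S. flag_act g base_flag \<in> W})"
proof -
  have "{g \<in> SL. flag_act g base_flag \<in> W} \<inter> SL_level S = {g \<in> SL_level S. flag_act g base_flag \<in> W}" for S
    by (auto simp: SL_level_def)
  moreover have "{g \<in> SL. flag_act g base_flag \<in> W} \<subseteq> (\<Union>S\<in>{S. finite S}. SL_level S)"
    unfolding SL_eq_Union by blast
  ultimately show ?thesis
    unfolding flag_topology_def openin_quotient_topology topspace_SL_topology flag_manifold_def
    by (simp add: SL_topology_def openin_direct_limit_topology topspace_pullback_topology)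
qed

lemma openin_D0: "openin flag_topology D0"
  unfolding openin_flag_topology_iff using openin_SL_level_D0 by (auto simp: D0_def)

subsection \<open>Continuity of the realization\<close>

text \<open>Contractivity bounds the image of \<open>y z\<close> by its own l2 norm, uniformly in
  the varying map \<open>X z\<close>. The common finite support turns coordinatewise convergence of
  \<open>y z\<close> into convergence of that norm.\<close>

lemma finitary_tendsto_0:
  fixes X :: "'z \<Rightarrow> 'q Vminus \<Rightarrow> Vplus"
  assumes X: "\<forall>\<^sub>F z in F. X z \<in> bounded_realization"
    and N: "finite N" "\<And>z. Poly_Mapping.keys (y z) \<subseteq> N"
    and y: "\<And>l. ((\<lambda>z. Poly_Mapping.lookup (y z) l) \<longlongrightarrow> 0) F"
  shows "((\<lambda>z. Poly_Mapping.lookup (X z (y z)) i) \<longlongrightarrow> 0) F"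
proof -
  have "((\<lambda>z. \<Sum>l\<in>N. (Poly_Mapping.lookup (y z) l)\<^sup>2) \<longlongrightarrow> (\<Sum>l\<in>N. 0\<^sup>2)) F"
    by (intro tendsto_intros y)
  then have "((\<lambda>z. dot (y z) (y z)) \<longlongrightarrow> 0) F"
    by (simp add: dot_eq_sum[OF N(1) disjI1[OF N(2)]] power2_eq_square)
  moreover have "\<forall>\<^sub>F z in F. norm ((Poly_Mapping.lookup (X z (y z)) i)\<^sup>2) \<le> dot (y z) (y z)"
    using X
  proof eventually_elim
    case (elim z)
    then have "linear (X z)" "strict_contraction (X z)"
      by (simp_all add: bounded_realization_iff finitary_maps_def)
    then have "dot (X z (y z)) (X z (y z)) \<le> dot (y z) (y z)"
      by (cases "y z = 0") (auto simp: linear_0 strict_contraction_def less_imp_le)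
    then show ?case
      using lookup_square_le_dot[of "X z (y z)" i] by simp
  qed
  ultimately have "((\<lambda>z. (Poly_Mapping.lookup (X z (y z)) i)\<^sup>2) \<longlongrightarrow> 0) F"
    by (rule Lim_null_comparison[rotated])
  then show ?thesis by (simp add: power_tendsto_0_iff)
qed

text \<open>Continuity of \<open>X\<^sub>g = B\<^sub>g D\<^sub>g\<inverse>\<close> without inverting \<open>D\<^sub>g\<close> near \<open>h\<close>: if \<open>D\<^sub>h y\<close> is the \<open>k\<close>-th basis
  vector, then \<open>X\<^sub>g D\<^sub>h y = X\<^sub>g (D\<^sub>h - D\<^sub>g) y + B\<^sub>g y\<close>, and \<open>X\<^sub>g\<close> is a contraction.\<close>

lemma continuous_map_flag_map_level:
  assumes S: "finite S"
  shows "continuous_map (subtopology (SL_level_topology S) {g. flag_act g base_flag \<in> D0})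
    (pullback_topology (finitary_level (Inl -` S, Inr -` S)) entry euclidean)
    (\<lambda>g. flag_map (flag_act g base_flag))" (is "continuous_map ?T _ ?f")
proof (rule continuous_map_into_pullback)
  have top: "topspace ?T = {g \<in> SL_level S. flag_act g base_flag \<in> D0}"
    by (auto simp: topspace_pullback_topology)
  have neg: "neg_def_subspace (g ` Vminus_space)" and lin: "linear g" and "bij g" "finite (moved g)"
    and off: "identity_off S g" if "g \<in> topspace ?T" for g
  proof -
    have *: "g \<in> SL_level S" "flag_act g base_flag \<in> D0" using that unfolding top by simp_all
    note SL = SL_level_SL[OF *(1)]
    show 1: "linear g" "bij g" "finite (moved g)"
      by (rule SL_linear[OF SL] SL_bij[OF SL] SL_finite_moved[OF SL])+
    show "neg_def_subspace (g ` Vminus_space)" using *(2) flag_act_base_in_D0_iff[OF 1] by simp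
    show "identity_off S g" by (rule SL_level_identity_off[OF *(1)])
  qed
  note g = this
  show "?f g \<in> finitary_level (Inl -` S, Inr -` S)" if "g \<in> topspace ?T" for g
    unfolding flag_map_flag_act_base[OF g(2-4,1)[OF that]]
    by (rule block_quotient_in_level[OF lin bij_is_inj S off neg]) (use that g(3) in auto)
  show "continuous_map ?T euclideanreal (\<lambda>g. entry (?f g) i k)" for i k
    unfolding continuous_map_atin limitin_canonical_iff
  proof
    fix h assume h: "h \<in> topspace ?T"
    let ?F = "atin ?T h"
    have ev: "\<forall>\<^sub>F g in ?F. g \<in> topspace ?T"
      by (auto simp: eventually_atin intro!: exI[of _ "topspace ?T"] h)
    have "continuous_map ?T euclideanreal (\<lambda>g. mat_entry g a b)" for a b
      by (rule continuous_map_from_subtopology[OF continuous_map_pullback_entry])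
    then have ent: "((\<lambda>g. mat_entry g a b) \<longlongrightarrow> mat_entry h a b) ?F" for a b
      using h unfolding continuous_map_atin limitin_canonical_iff by (rule bspec)
    have X: "?f g \<in> bounded_realization" "?f g (block_D g v) = block_B g v"
      if "g \<in> topspace ?T" for g v
      using flag_map_flag_act_base_in[OF g(2-4,1)[OF that]]
        flag_map_flag_act_base[OF g(2-4,1)[OF that]] bij_block_D_neg_def[OF g(2-4,1)[OF that]]
      by (simp_all add: bij_is_inj)
    \<comment> \<open>\<open>y\<close> depends only on the limit point \<open>h\<close> and stays
      fixed while \<open>g\<close> varies.\<close>
    define y where "y = inv (block_D h) (Poly_Mapping.single k 1)"
    have y: "block_D h y = Poly_Mapping.single k 1"
      unfolding y_def using bij_block_D_neg_def[OF g(2-4,1)[OF h]]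
      by (simp add: bij_is_surj surj_f_inv_f)
    \<comment> \<open>The value 0 off the space makes the support bound hold for every
      \<open>g\<close>, as \<open>finitary_tendsto_0\<close> requires.\<close>
    define d where "d g = (if g \<in> topspace ?T then block_D h y - block_D g y else 0)" for g
    have keys: "Poly_Mapping.keys (d g) \<subseteq> Inr -` S" for g
    proof (cases "g \<in> topspace ?T")
      case True
      \<comment> \<open>Outside \<open>S\<close> both \<open>block_D h y\<close> and
        \<open>block_D g y\<close> have the coordinates of \<open>y\<close>.\<close>
      have "Poly_Mapping.lookup (d g) k = 0" if "Inr k \<notin> S" for k
        using lookup_block_D_off[OF lin[OF True] off[OF True] that, of y]
          lookup_block_D_off[OF lin[OF h] off[OF h] that, of y] True
        by (simp add: d_def lookup_minus)
      then show ?thesis by (fastforce simp only: in_keys_iff subset_eq vimage_eq)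
    next
      case False
      then show ?thesis unfolding d_def by (simp only: if_False keys_zero empty_subsetI)
    qed
    have d_0: "((\<lambda>g. Poly_Mapping.lookup (d g) l) \<longlongrightarrow> 0) ?F" for l
    proof -
      let ?D = "\<lambda>g. \<Sum>j\<in>Poly_Mapping.keys y. Poly_Mapping.lookup y j * mat_entry g (Inr l) (Inr j)"
      have "((\<lambda>g. ?D h - ?D g) \<longlongrightarrow> ?D h - ?D h) ?F" by (intro tendsto_intros ent)
      then have "((\<lambda>g. ?D h - ?D g) \<longlongrightarrow> 0) ?F" by simp
      moreover have "\<forall>\<^sub>F g in ?F. ?D h - ?D g = Poly_Mapping.lookup (d g) l"
        using ev
      proof eventually_elim
        case (elim g)
        then show ?case
          by (simp add: d_def lookup_minus lookup_block_D[OF lin[OF elim]] lookup_block_D[OF lin[OF h]])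
      qed
      ultimately show ?thesis by (rule Lim_transform_eventually)
    qed
    have lim_d: "((\<lambda>g. Poly_Mapping.lookup (?f g (d g)) i) \<longlongrightarrow> 0) ?F"
    proof (rule finitary_tendsto_0[OF _ finite_vimageI[OF S inj_Inr] keys d_0])
      show "\<forall>\<^sub>F g in ?F. ?f g \<in> bounded_realization"
        by (rule eventually_mono[OF ev X(1)])
    qed
    let ?B = "\<lambda>g. \<Sum>j\<in>Poly_Mapping.keys y. Poly_Mapping.lookup y j * mat_entry g (Inl i) (Inr j)"
    have "((\<lambda>g. Poly_Mapping.lookup (?f g (d g)) i + ?B g) \<longlongrightarrow> 0 + ?B h) ?F"
      by (intro tendsto_intros ent lim_d)
    moreover have "0 + ?B h = entry (?f h) i k"
      using X(2)[OF h, of y] by (simp add: entry_def y lookup_block_B[OF lin[OF h]])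
    moreover have "\<forall>\<^sub>F g in ?F. Poly_Mapping.lookup (?f g (d g)) i + ?B g = entry (?f g) i k"
      using ev
    proof eventually_elim
      case (elim g)
      have "linear (?f g)" using X(1)[OF elim] by (simp add: bounded_realization_iff finitary_maps_def)
      then have "?f g (d g) + block_B g y = ?f g (Poly_Mapping.single k 1)"
        using X(2)[OF elim, of y] elim by (simp add: d_def linear_diff y)
      then show ?case
        by (simp add: entry_def lookup_block_B[OF lin[OF elim], symmetric] flip: lookup_add)
    qed
    ultimately show "((\<lambda>g. entry (?f g) i k) \<longlongrightarrow> entry (?f h) i k) ?F"
      by (simp only: Lim_transform_eventually)
  qed
qed

text \<open>Openness of a preimage is tested on the finite levels of the group, where continuity of
  the realization is known.\<close>

lemma continuous_map_flag_map:
  "continuous_map (subtopology flag_topology D0) finitary_topology flag_map"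
  unfolding continuous_map_def
proof (intro conjI allI impI)
  show "flag_map \<in> topspace (subtopology flag_topology D0) \<rightarrow> topspace finitary_topology"
    by (auto simp: topspace_finitary_topology D0_eq bounded_realization_iff)
  fix W :: "('a Vminus \<Rightarrow> Vplus) set" assume W: "openin finitary_topology W"
  let ?V = "{f \<in> D0. flag_map f \<in> W}"
  have "openin flag_topology ?V"
    unfolding openin_flag_topology_iff
  proof (intro conjI allI impI)
    show "?V \<subseteq> flag_manifold" by (auto simp: D0_def)
    fix S :: "(nat + 'a) set" assume S: "finite S"
    let ?T = "subtopology (SL_level_topology S) {g. flag_act g base_flag \<in> D0}"
    have "continuous_map ?T finitary_topology (\<lambda>g. flag_map (flag_act g base_flag))"
      unfolding finitary_topology_def
      by (rule continuous_map_into_direct_limit[where i = "(Inl -` S, Inr -` S)"])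
        (simp add: S finite_vimageI, rule continuous_map_flag_map_level[OF S])
    from openin_continuous_map_preimage[OF this W]
    have "openin ?T {g \<in> SL_level S. flag_act g base_flag \<in> ?V}"
      by (rule back_subst[of "openin ?T"]) (auto simp: topspace_pullback_topology)
    moreover have "topspace (SL_level_topology S) \<inter> {g. flag_act g base_flag \<in> D0}
        = {g \<in> SL_level S. flag_act g base_flag \<in> D0}"
      by (auto simp: topspace_pullback_topology)
    then have "?T = subtopology (SL_level_topology S) {g \<in> SL_level S. flag_act g base_flag \<in> D0}"
      using subtopology_restrict[of "SL_level_topology S" "{g. flag_act g base_flag \<in> D0}"]
      by (simp only:)
    \<comment> \<open>The preimage of \<open>D0\<close> is open in the level, so a set open relative
      to it is open in the level.\<close>
    ultimately show "openin (SL_level_topology S) {g \<in> SL_level S. flag_act g base_flag \<in> ?V}"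
      using openin_trans_full[OF _ openin_SL_level_D0[OF S]] by simp
  qed
  moreover have "{f \<in> topspace (subtopology flag_topology D0). flag_map f \<in> W} = ?V"
    by (auto simp: topspace_flag_topology D0_def)
  ultimately show "openin (subtopology flag_topology D0)
      {f \<in> topspace (subtopology flag_topology D0). flag_map f \<in> W}"
    by (simp add: openin_open_subtopology[OF openin_D0])
qed

text \<open>It is the preimage of \<open>D0\<close> under the continuous map
  \<open>graph_flag\<close>, whose injectivity rules out further points.\<close>

lemma openin_bounded_realization:
  "openin finitary_topology (bounded_realization :: ('q Vminus \<Rightarrow> Vplus) set)"
proof -
  have "openin finitary_topology
      {X \<in> topspace finitary_topology. graph_flag (X :: 'q Vminus \<Rightarrow> Vplus) \<in> D0}"
    by (rule openin_continuous_map_preimage[OF continuous_map_graph_flag openin_D0])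
  moreover have "{X \<in> topspace finitary_topology. graph_flag X \<in> D0}
      = (bounded_realization :: ('q Vminus \<Rightarrow> Vplus) set)"
  proof (intro equalityI subsetI)
    fix X :: "'q Vminus \<Rightarrow> Vplus" assume "X \<in> {X \<in> topspace finitary_topology. graph_flag X \<in> D0}"
    then obtain Y where "Y \<in> bounded_realization" "graph_flag X = graph_flag Y" by (auto simp: D0_eq)
    then show "X \<in> bounded_realization" by (metis flag_map_graph_flag)
  next
    fix X :: "'q Vminus \<Rightarrow> Vplus" assume "X \<in> bounded_realization"
    then show "X \<in> {X \<in> topspace finitary_topology. graph_flag X \<in> D0}"
      by (simp add: topspace_finitary_topology graph_flag_in_D0 bounded_realization_iff)
  qed
  ultimately show ?thesis by simp
qed

section \<open>Homeomorphism and domain properties\<close>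

lemma homeomorphic_map_flag_map:
  "homeomorphic_map (subtopology flag_topology D0)
     (subtopology finitary_topology bounded_realization) flag_map"
  unfolding homeomorphic_map_maps homeomorphic_maps_def
proof (intro exI[of _ graph_flag] conjI)
  show "continuous_map (subtopology flag_topology D0)
      (subtopology finitary_topology bounded_realization) flag_map"
    by (rule continuous_map_into_subtopology[OF continuous_map_flag_map]) (auto simp: D0_eq)
  show "continuous_map (subtopology finitary_topology bounded_realization)
      (subtopology flag_topology D0) graph_flag"
    by (rule continuous_map_into_subtopology
        [OF continuous_map_from_subtopology[OF continuous_map_graph_flag]]) (auto simp: D0_eq)
qed (auto simp: D0_eq)

lemma domain_in_D0: "domain_in flag_topology D0"
  unfolding domain_in_def
proof (intro conjI)
  show "connectedin flag_topology D0"
    unfolding D0_eq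
    by (rule connectedin_continuous_map_image[OF continuous_map_graph_flag connectedin_bounded_realization])
qed (use openin_D0 zero_in_bounded_realization in \<open>auto simp: D0_eq\<close>)

lemma domain_in_bounded_realization: "domain_in finitary_topology bounded_realization"
  unfolding domain_in_def
  using openin_bounded_realization connectedin_bounded_realization zero_in_bounded_realization by blast

theorem proposition6p1p4:
  shows "domain_in flag_topology (D0 :: 'q::countable flag set)
    \<and> domain_in finitary_topology (bounded_realization :: ('q Vminus \<Rightarrow> Vplus) set)
    \<and> bounded_maps (bounded_realization :: ('q Vminus \<Rightarrow> Vplus) set)
    \<and> (\<forall>F1. ({0}, F1, UNIV) \<in> (D0 :: 'q flag set) \<longrightarrow>
          bij_betw proj_minus F1 UNIV
          \<and> (\<forall>x\<in>F1. flag_map ({0}, F1, UNIV) (proj_minus x) = proj_plus x))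
    \<and> bij_betw flag_map (D0 :: 'q flag set) bounded_realization
    \<and> homeomorphic_map (subtopology flag_topology (D0 :: 'q flag set))
          (subtopology finitary_topology bounded_realization) flag_map
    \<and> (\<forall>g\<in>G0. \<forall>f\<in>(D0 :: 'q flag set).
          flag_act g f \<in> D0
          \<and> (let X = flag_map f in
               bij (\<lambda>v. block_C g (X v) + block_D g v)
               \<and> flag_map (flag_act g f)
                   = (\<lambda>v. block_A g (X v) + block_B g v)
                     \<circ> inv (\<lambda>v. block_C g (X v) + block_D g v)))"
proof (intro conjI ballI allI impI)
  show "domain_in flag_topology (D0 :: 'q flag set)" by (rule domain_in_D0)
  show "domain_in finitary_topology (bounded_realization :: ('q Vminus \<Rightarrow> Vplus) set)"
    by (rule domain_in_bounded_realization)
  show "bounded_maps (bounded_realization :: ('q Vminus \<Rightarrow> Vplus) set)"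
    by (rule bounded_maps_bounded_realization)
  show "bij_betw flag_map (D0 :: 'q flag set) bounded_realization" by (rule bij_betw_flag_map)
  show "homeomorphic_map (subtopology flag_topology (D0 :: 'q flag set))
      (subtopology finitary_topology bounded_realization) flag_map"
    by (rule homeomorphic_map_flag_map)
next
  fix F1 :: "'q V set" assume "({0}, F1, UNIV) \<in> (D0 :: 'q flag set)"
  note * = D0_graph[OF this]
  show "bij_betw proj_minus F1 UNIV" by (rule *(1))
  show "flag_map ({0}, F1, UNIV) (proj_minus x) = proj_plus x" if "x \<in> F1" for x
    by (rule *(2)[OF that])
next
  fix g :: "'q V \<Rightarrow> 'q V" and f assume g: "g \<in> G0" and "f \<in> (D0 :: 'q flag set)"
  \<comment> \<open>Writing the flag as a graph turns \<open>flag_map f\<close> into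
    \<open>X\<close>, so the action formula for graphs applies.\<close>
  then obtain X where X: "X \<in> bounded_realization" "f = graph_flag X" by (auto simp: D0_eq)
  note * = G0_action[OF _ _ X(1), of g] G0_isometry[OF g]
  show "flag_act g f \<in> D0" unfolding X(2) using * by blast
  show "let X = flag_map f in
      bij (\<lambda>v. block_C g (X v) + block_D g v)
      \<and> flag_map (flag_act g f)
          = (\<lambda>v. block_A g (X v) + block_B g v)
            \<circ> inv (\<lambda>v. block_C g (X v) + block_D g v)"
    unfolding X(2) Let_def flag_map_graph_flag using * by blast
qed

end
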